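(* Let $G = T \cup C$ be a complete Halin graph that is not a wheel (that is, $G \neq W_n$ for every $n$), with maximum degree $\Delta = \Delta(G) \geq 6$. Then $\chi'_{\mathrm{star}}(G) \leq \left\lfloor \frac{3\Delta}{2} \right\rfloor + 1$.
   Context: All graphs are simple, finite and undirected. A Halin graph is a plane graph that consists of a plane embedding of a tree $T$ and a cycle $C$, where the cycle $C$ connects the leaves of $T$ (the vertices of $C$ are exactly the leaves of $T$) in such a way that $C$ is the boundary of the exterior face, and every interior (non-leaf) vertex of $T$ has degree at least three. One writes $G = T \cup C$; $T$ is the characteristic tree and $C$ the adjoint cycle of $G$. A complete Halin graph is a Halin graph whose characteristic tree $T$ has a root vertex such that all leaves of $T$ are at the same distance from the root vertex. $W_n$ denotes a wheel (a Halin graph whose characteristic tree is a star). A star $k$-edge-coloring of a graph $G$ is a proper edge-coloring of $G$ with $k$ colors such that no path of length four and no cycle of length four in $G$ (length = number of edges) is bicolored, i.e., at least three colors appear on every path or cycle of length four. The star chromatic index $\chi_{\mathrm{star}}'(G)$ is the smallest $k$ such that $G$ has a star $k$-edge-coloring. *)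

theory Defs
  imports "HOL-Analysis.Analysis"
begin

section \<open>Finite simple graphs\<close>

text \<open>A graph is given by a vertex set \<open>V\<close> and a set \<open>E\<close> of two-element subsets of \<open>V\<close>.\<close>

definition simple_graph :: "'a set \<Rightarrow> 'a set set \<Rightarrow> bool" where
  "simple_graph V E \<longleftrightarrow> finite V \<and> (\<forall>e\<in>E. e \<subseteq> V \<and> card e = 2)"

definition degree :: "'a set set \<Rightarrow> 'a \<Rightarrow> nat" where
  "degree E v = card {e \<in> E. v \<in> e}"

definition max_degree :: "'a set \<Rightarrow> 'a set set \<Rightarrow> nat" where
  "max_degree V E = Max (degree E ` V)"

text \<open>Paths and cycles are given by their lists of pairwise distinct vertices. A path on the list
  \<open>p\<close> has \<open>length p - 1\<close> edges; a cycle on the list \<open>p\<close> has \<open>length p\<close> edges, including the one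
  that joins the last vertex to the first.\<close>

definition path_edges :: "'a list \<Rightarrow> 'a set set" where
  "path_edges p = {{p ! i, p ! Suc i} | i. Suc i < length p}"

definition cycle_edges :: "'a list \<Rightarrow> 'a set set" where
  "cycle_edges p = {{p ! i, p ! (Suc i mod length p)} | i. i < length p}"

definition graph_path :: "'a set \<Rightarrow> 'a set set \<Rightarrow> 'a list \<Rightarrow> bool" where
  "graph_path V E p \<longleftrightarrow> p \<noteq> [] \<and> distinct p \<and> set p \<subseteq> V \<and> path_edges p \<subseteq> E"

definition graph_cycle :: "'a set \<Rightarrow> 'a set set \<Rightarrow> 'a list \<Rightarrow> bool" where
  "graph_cycle V E p \<longleftrightarrow> length p \<ge> 3 \<and> distinct p \<and> set p \<subseteq> V \<and> cycle_edges p \<subseteq> E"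

definition connected_graph :: "'a set \<Rightarrow> 'a set set \<Rightarrow> bool" where
  "connected_graph V E \<longleftrightarrow>
     V \<noteq> {} \<and> (\<forall>u\<in>V. \<forall>v\<in>V. \<exists>p. graph_path V E p \<and> hd p = u \<and> last p = v)"

definition graph_dist :: "'a set \<Rightarrow> 'a set set \<Rightarrow> 'a \<Rightarrow> 'a \<Rightarrow> nat" where
  "graph_dist V E u v =
     (LEAST n. \<exists>p. graph_path V E p \<and> hd p = u \<and> last p = v \<and> length p = Suc n)"

definition tree :: "'a set \<Rightarrow> 'a set set \<Rightarrow> bool" where
  "tree V T \<longleftrightarrow> simple_graph V T \<and> connected_graph V T \<and> (\<nexists>p. graph_cycle V T p)"

definition leaves :: "'a set \<Rightarrow> 'a set set \<Rightarrow> 'a set" where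
  "leaves V T = {v \<in> V. degree T v = 1}"

definition star :: "'a set \<Rightarrow> 'a set set \<Rightarrow> bool" where
  "star V T \<longleftrightarrow> (\<exists>z\<in>V. T = {{z, v} | v. v \<in> V - {z}})"


section \<open>Plane graphs\<close>

text \<open>The plane is \<^typ>\<open>complex\<close>. A plane embedding places the vertices at distinct points \<open>pos v\<close>
  and draws each edge \<open>e\<close> as an arc \<open>\<gamma> e\<close> joining the two ends of \<open>e\<close>. An arc meets the vertices
  only in its own ends, and two arcs meet only in common ends.\<close>

definition plane_embedding ::
  "'a set \<Rightarrow> 'a set set \<Rightarrow> ('a \<Rightarrow> complex) \<Rightarrow> ('a set \<Rightarrow> real \<Rightarrow> complex) \<Rightarrow> bool" where
  "plane_embedding V E pos \<gamma> \<longleftrightarrow>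
     inj_on pos V \<and>
     (\<forall>e\<in>E. arc (\<gamma> e) \<and> {pathstart (\<gamma> e), pathfinish (\<gamma> e)} = pos ` e \<and>
             path_image (\<gamma> e) \<inter> pos ` V = pos ` e) \<and>
     (\<forall>e\<in>E. \<forall>f\<in>E. e \<noteq> f \<longrightarrow> path_image (\<gamma> e) \<inter> path_image (\<gamma> f) = pos ` (e \<inter> f))"

definition drawing ::
  "'a set \<Rightarrow> 'a set set \<Rightarrow> ('a \<Rightarrow> complex) \<Rightarrow> ('a set \<Rightarrow> real \<Rightarrow> complex) \<Rightarrow> complex set" where
  "drawing V E pos \<gamma> = pos ` V \<union> (\<Union>e\<in>E. path_image (\<gamma> e))"

text \<open>The faces are the components of the complement of the drawing. The drawing of a finite graph
  is bounded, so exactly one face is unbounded and it is the set \<^const>\<open>outside\<close> of the drawing.\<close>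

definition exterior_face ::
  "'a set \<Rightarrow> 'a set set \<Rightarrow> ('a \<Rightarrow> complex) \<Rightarrow> ('a set \<Rightarrow> real \<Rightarrow> complex) \<Rightarrow> complex set" where
  "exterior_face V E pos \<gamma> = outside (drawing V E pos \<gamma>)"


section \<open>Halin graphs\<close>

text \<open>In the following, \<open>T\<close> and \<open>C\<close> are the edge sets of the characteristic tree (which spans \<open>V\<close>)
  and of the adjoint cycle; the Halin graph itself has the edge set \<open>T \<union> C\<close>.\<close>

definition halin_graph ::
  "'a set \<Rightarrow> 'a set set \<Rightarrow> 'a set set \<Rightarrow> ('a \<Rightarrow> complex) \<Rightarrow> ('a set \<Rightarrow> real \<Rightarrow> complex) \<Rightarrow> bool" where
  "halin_graph V T C pos \<gamma> \<longleftrightarrow>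
     tree V T \<and>
     (\<forall>v \<in> V - leaves V T. degree T v \<ge> 3) \<and>
     (\<exists>p. graph_cycle V C p \<and> cycle_edges p = C \<and> set p = leaves V T) \<and>
     plane_embedding V (T \<union> C) pos \<gamma> \<and>
     frontier (exterior_face V (T \<union> C) pos \<gamma>) = (\<Union>e\<in>C. path_image (\<gamma> e))"

definition complete_halin_graph ::
  "'a set \<Rightarrow> 'a set set \<Rightarrow> 'a set set \<Rightarrow> ('a \<Rightarrow> complex) \<Rightarrow> ('a set \<Rightarrow> real \<Rightarrow> complex) \<Rightarrow> bool" where
  "complete_halin_graph V T C pos \<gamma> \<longleftrightarrow>
     halin_graph V T C pos \<gamma> \<and>
     (\<exists>r\<in>V. \<exists>d. \<forall>l \<in> leaves V T. graph_dist V T r l = d)"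

definition wheel ::
  "'a set \<Rightarrow> 'a set set \<Rightarrow> 'a set set \<Rightarrow> ('a \<Rightarrow> complex) \<Rightarrow> ('a set \<Rightarrow> real \<Rightarrow> complex) \<Rightarrow> bool" where
  "wheel V T C pos \<gamma> \<longleftrightarrow> halin_graph V T C pos \<gamma> \<and> star V T"


section \<open>Star edge-colorings\<close>

definition proper_edge_coloring :: "'a set set \<Rightarrow> nat \<Rightarrow> ('a set \<Rightarrow> nat) \<Rightarrow> bool" where
  "proper_edge_coloring E k c \<longleftrightarrow>
     c ` E \<subseteq> {..<k} \<and> (\<forall>e\<in>E. \<forall>f\<in>E. e \<noteq> f \<longrightarrow> e \<inter> f \<noteq> {} \<longrightarrow> c e \<noteq> c f)"

definition star_edge_coloring :: "'a set \<Rightarrow> 'a set set \<Rightarrow> nat \<Rightarrow> ('a set \<Rightarrow> nat) \<Rightarrow> bool" where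
  "star_edge_coloring V E k c \<longleftrightarrow>
     proper_edge_coloring E k c \<and>
     (\<forall>p. graph_path V E p \<longrightarrow> length p = 5 \<longrightarrow> card (c ` path_edges p) \<ge> 3) \<and>
     (\<forall>p. graph_cycle V E p \<longrightarrow> length p = 4 \<longrightarrow> card (c ` cycle_edges p) \<ge> 3)"

definition star_chromatic_index :: "'a set \<Rightarrow> 'a set set \<Rightarrow> nat" where
  "star_chromatic_index V E = (LEAST k. \<exists>c. star_edge_coloring V E k c)"

end

theory Submission imports Defs
begin

text \<open>
  Write \<open>D\<close> for the maximum degree and \<open>K = 3 * D div 2\<close>. The tree can be colored with \<open>K\<close>
  colors, and one additional color suffices to fit the adjoint cycle in.

  \<^emph>\<open>The tree.\<close> Give every vertex \<open>v\<close> a cyclic list of \<open>D\<close> colors from which the edges at \<open>v\<close> are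
  colored. Grow the tree leaf by leaf. If a new vertex \<open>w\<close> is hung on \<open>v\<close> by an edge of the color at
  position \<open>i\<close> of the list of \<open>v\<close>, then the list of \<open>w\<close> consists of this color, the next
  \<open>(D - 1) div 2\<close> colors in the list of \<open>v\<close>, and the \<open>D div 2\<close> colors that are absent from the list of
  \<open>v\<close>. A bicolored path with middle vertex \<open>v\<close> would give two distinct positions in the list of \<open>v\<close> each
  of which is at most \<open>(D - 1) div 2\<close> steps ahead of the other, which is impossible on a cycle of
  length \<open>D\<close> (\<open>tree_star_coloring\<close>).

  \<^emph>\<open>The order of the leaves.\<close> All leaves have the same distance from the root, so a vertex adjacent to a
  leaf has at most one neighbour that is not a leaf; it has degree at least three, so its leaf
  neighbours form a family of at least two. By planarity a family is an interval of the adjoint cycle: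
  two of its leaves together with their common neighbour span a chord of the disc bounded by the
  cycle, and a path of the tree between two foreign leaves cannot cross this chord
  (\<open>children_contiguous\<close>). As the tree is not a star, there are at least two families.

  \<^emph>\<open>The cycle.\<close> The edges of the cycle between different families receive the additional color; no two
  of them are adjacent, because families have at least two members. An edge inside the family of
  \<open>u\<close> receives a color that does not occur at \<open>u\<close>. As \<open>K - D \<ge> 3\<close>, three such colors exist, and
  repeating them with period three along the interval makes any three consecutive edges differ.
  The additional color can occur twice on a bicolored path only if it surrounds a family of two
  leaves. Its vertex \<open>u\<close> has degree three, so the single edge inside it can also avoid the at most four
  colors that would create such a path: \<open>3 + 4 < 9 \<le> K\<close> (\<open>isolated_constraints\<close>). Thus no bicolored path or
  cycle of length four meets the adjoint cycle (\<open>star_coloring_with_cycle\<close>).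
\<close>


section \<open>Edges of paths and cycles\<close>

lemma path_edges_Nil [simp]: "path_edges [] = {}"
  and path_edges_single [simp]: "path_edges [x] = {}"
  by (auto simp: path_edges_def)

lemma path_edges_Cons [simp]: "path_edges (x # y # p) = insert {x, y} (path_edges (y # p))"
proof -
  have "path_edges (x # y # p) =
      (\<lambda>i. {(x # y # p) ! i, (x # y # p) ! Suc i}) ` {i. Suc i < length (x # y # p)}"
    by (auto simp: path_edges_def)
  also have "{i. Suc i < length (x # y # p)} = insert 0 (Suc ` {i. Suc i < length (y # p)})"
    by (auto simp: image_iff) (metis less_Suc_eq_0_disj)
  also have "(\<lambda>i. {(x # y # p) ! i, (x # y # p) ! Suc i}) ` \<dots> =
      insert {x, y} ((\<lambda>i. {(y # p) ! i, (y # p) ! Suc i}) ` {i. Suc i < length (y # p)})"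
    by (simp add: image_image)
  also have "(\<lambda>i. {(y # p) ! i, (y # p) ! Suc i}) ` {i. Suc i < length (y # p)} = path_edges (y # p)"
    by (auto simp: path_edges_def)
  finally show ?thesis .
qed

lemma path_edges_append:
  "path_edges (xs @ b # ys) = path_edges (xs @ [b]) \<union> path_edges (b # ys)"
proof (induction xs)
  case (Cons x xs)
  then show ?case by (cases xs) auto
qed simp

lemma path_edges_snoc:
  "p \<noteq> [] \<Longrightarrow> path_edges (p @ [v]) = insert {last p, v} (path_edges p)"
proof (induction p)
  case (Cons x p)
  then show ?case by (cases p) auto
qed simp

lemma path_edges_rev: "path_edges (rev p) = path_edges p"
proof (induction p)
  case (Cons x p)
  then show ?case
    by (cases p) (auto simp: path_edges_snoc[where p = "rev _ @ [_]", simplified] insert_commute)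
qed simp

lemma cycle_edges_eq_path_edges: "cycle_edges (a # p) = path_edges (a # p @ [a])"
proof (intro equalityI subsetI)
  let ?n = "length (a # p)"
  have succ: "(a # p) ! (Suc i mod ?n) = (a # p @ [a]) ! Suc i"
    and same: "(a # p) ! i = (a # p @ [a]) ! i" if "i < ?n" for i
  proof -
    show "(a # p) ! (Suc i mod ?n) = (a # p @ [a]) ! Suc i"
      using that by (cases "Suc i = ?n") (auto simp: nth_append less_Suc_eq_le)
    show "(a # p) ! i = (a # p @ [a]) ! i"
      using that by (cases i) (auto simp: nth_append)
  qed
  fix e
  { assume "e \<in> cycle_edges (a # p)"
    then obtain i where "i < ?n" "e = {(a # p) ! i, (a # p) ! (Suc i mod ?n)}"
      unfolding cycle_edges_def by blast
    then show "e \<in> path_edges (a # p @ [a])"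
      unfolding path_edges_def using succ[of i] same[of i] by auto }
  { assume "e \<in> path_edges (a # p @ [a])"
    then obtain i where "i < ?n" "e = {(a # p @ [a]) ! i, (a # p @ [a]) ! Suc i}"
      unfolding path_edges_def by auto
    then show "e \<in> cycle_edges (a # p)"
      unfolding cycle_edges_def mem_Collect_eq using succ[of i] same[of i] by metis }
qed

lemma cycle_edges_rotate: "cycle_edges (xs @ ys) = cycle_edges (ys @ xs)"
proof (cases xs)
  case xs: (Cons a xs')
  show ?thesis
  proof (cases ys)
    case ys: (Cons b ys')
    have "cycle_edges (xs @ ys) = path_edges ((a # xs') @ b # ys' @ [a])"
      using xs ys by (simp add: cycle_edges_eq_path_edges)
    also have "\<dots> = path_edges (a # xs' @ [b]) \<union> path_edges (b # ys' @ [a])"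
      using path_edges_append[of "a # xs'" b "ys' @ [a]"] by simp
    also have "\<dots> = path_edges ((b # ys') @ a # xs' @ [b])"
      using path_edges_append[of "b # ys'" a "xs' @ [b]"] by auto
    also have "\<dots> = cycle_edges (ys @ xs)"
      using xs ys by (simp add: cycle_edges_eq_path_edges)
    finally show ?thesis .
  qed simp
qed simp

lemma Union_path_edges: "2 \<le> length p \<Longrightarrow> \<Union> (path_edges p) = set p"
proof (induction p)
  case (Cons x p)
  then show ?case
  proof (cases p)
    case (Cons y q)
    then show ?thesis using Cons.IH by (cases q) auto
  qed auto
qed simp

lemma path_edge_subset: "e \<in> path_edges p \<Longrightarrow> e \<subseteq> set p"
  by (auto simp: path_edges_def)

lemma finite_path_edges [simp]: "finite (path_edges p)"
proof -
  have "path_edges p = (\<lambda>i. {p ! i, p ! Suc i}) ` {i. Suc i < length p}"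
    by (auto simp: path_edges_def)
  then show ?thesis by (simp add: finite_subset[of _ "{..<length p}"] subset_iff)
qed

section \<open>Star edge-colorings in terms of walks\<close>

text \<open>One condition for both forbidden configurations: a 4-cycle is the case \<open>x5 = x1\<close>. The other
  coincidences, \<open>x1 = x4\<close> and \<open>x2 = x5\<close>, make two edges of equal color adjacent, so that in a proper
  coloring exactly the bicolored paths and cycles are excluded.\<close>

definition no_bicolored_walk :: "'a set set \<Rightarrow> ('a set \<Rightarrow> nat) \<Rightarrow> bool" where
  "no_bicolored_walk E c \<longleftrightarrow>
     (\<forall>x1 x2 x3 x4 x5. {x1, x2} \<in> E \<longrightarrow> {x2, x3} \<in> E \<longrightarrow> {x3, x4} \<in> E \<longrightarrow> {x4, x5} \<in> E \<longrightarrow>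
        x1 \<noteq> x3 \<longrightarrow> x2 \<noteq> x4 \<longrightarrow> x3 \<noteq> x5 \<longrightarrow> c {x1, x2} = c {x3, x4} \<longrightarrow> c {x2, x3} \<noteq> c {x4, x5})"

lemma card_ge_3_if_alternation_fails:
  fixes a b c d :: nat
  assumes "a \<noteq> b" "b \<noteq> c" "c \<noteq> d" "a = c \<longrightarrow> b \<noteq> d"
  shows "3 \<le> card {a, b, c, d}"
  using assms by (auto simp: card_insert_if)

lemma list_of_length_4: "length p = 4 \<Longrightarrow> \<exists>a b c d. p = [a, b, c, d]"
  by (auto simp: length_Suc_conv eval_nat_numeral)

lemma list_of_length_5: "length p = 5 \<Longrightarrow> \<exists>a b c d e. p = [a, b, c, d, e]"
  by (auto simp: length_Suc_conv eval_nat_numeral)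

lemma star_edge_coloringI:
  assumes proper: "proper_edge_coloring E k c" and walks: "no_bicolored_walk E c"
  shows "star_edge_coloring V E k c"
proof -
  have walk: "3 \<le> card {c {x1, x2}, c {x2, x3}, c {x3, x4}, c {x4, x5}}"
    if "{x1, x2} \<in> E" "{x2, x3} \<in> E" "{x3, x4} \<in> E" "{x4, x5} \<in> E"
      "x1 \<noteq> x3" "x2 \<noteq> x4" "x3 \<noteq> x5" for x1 x2 x3 x4 x5
  proof (rule card_ge_3_if_alternation_fails)
    have "c {x, y} \<noteq> c {y, z}" if "{x, y} \<in> E" "{y, z} \<in> E" "x \<noteq> z" for x y z
      using proper that unfolding proper_edge_coloring_def
      by (metis disjoint_insert(1) doubleton_eq_iff inf_bot_right insertI1 insert_commute insert_disjoint(1))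
    then show "c {x1, x2} \<noteq> c {x2, x3}" "c {x2, x3} \<noteq> c {x3, x4}" "c {x3, x4} \<noteq> c {x4, x5}"
      using that by blast+
    show "c {x1, x2} = c {x3, x4} \<longrightarrow> c {x2, x3} \<noteq> c {x4, x5}"
      using walks that unfolding no_bicolored_walk_def by blast
  qed
  have "3 \<le> card (c ` path_edges p)" if "graph_path V E p" "length p = 5" for p
  proof -
    from list_of_length_5[OF that(2)] obtain x1 x2 x3 x4 x5 where p: "p = [x1, x2, x3, x4, x5]"
      by blast
    show ?thesis
      using that(1) walk[of x1 x2 x3 x4 x5] unfolding graph_path_def p by simp
  qed
  moreover have "3 \<le> card (c ` cycle_edges p)" if "graph_cycle V E p" "length p = 4" for p
  proof -
    from list_of_length_4[OF that(2)] obtain x1 x2 x3 x4 where p: "p = [x1, x2, x3, x4]"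
      by blast
    show ?thesis
      using that(1) walk[of x1 x2 x3 x4 x1] unfolding graph_cycle_def p
      by (auto simp: cycle_edges_eq_path_edges)
  qed
  ultimately show ?thesis
    using proper unfolding star_edge_coloring_def by blast
qed


section \<open>Trees grown from a root\<close>

text \<open>Finite trees as the graphs that arise by adding leaves one at a time: this gives the induction
  principle for both the depth function and the coloring.\<close>

inductive grown :: "'a \<Rightarrow> 'a set \<Rightarrow> 'a set set \<Rightarrow> bool" for r where
  root: "grown r {r} {}"
| sprout: "grown r V E \<Longrightarrow> u \<in> V \<Longrightarrow> v \<notin> V \<Longrightarrow> grown r (insert v V) (insert {u, v} E)"

lemma grown_edge_subset: "grown r V E \<Longrightarrow> e \<in> E \<Longrightarrow> e \<subseteq> V"
  by (induction rule: grown.induct) auto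

lemma grown_finite: "grown r V E \<Longrightarrow> finite V \<and> finite E \<and> r \<in> V"
  by (induction rule: grown.induct) auto

lemma graph_path_mono: "graph_path V E p \<Longrightarrow> V \<subseteq> W \<Longrightarrow> E \<subseteq> F \<Longrightarrow> graph_path W F p"
  by (auto simp: graph_path_def)

lemma graph_path_rev: "graph_path V E (rev p) \<longleftrightarrow> graph_path V E p"
  by (simp add: graph_path_def path_edges_rev)

lemma graph_path_snoc:
  "graph_path V E p \<Longrightarrow> v \<notin> V \<Longrightarrow> graph_path (insert v V) (insert {last p, v} E) (p @ [v])"
  by (auto simp: graph_path_def path_edges_snoc)

lemma grown_connected:
  assumes "grown r V E" "x \<in> V" "y \<in> V"
  shows "\<exists>p. graph_path V E p \<and> hd p = x \<and> last p = y"
  using assms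
proof (induction arbitrary: x y rule: grown.induct)
  case root
  then show ?case by (intro exI[of _ "[r]"]) (auto simp: graph_path_def)
next
  case (sprout V E u v)
  let ?W = "insert v V" and ?F = "insert {u, v} E"
  have new: "\<exists>p. graph_path ?W ?F p \<and> hd p = x \<and> last p = v" if x: "x \<in> V" for x
  proof -
    obtain p where p: "graph_path V E p" "hd p = x" "last p = u"
      using sprout.IH[OF x sprout.hyps(2)] by blast
    with graph_path_snoc[OF p(1) sprout.hyps(3)] show ?thesis
      by (intro exI[of _ "p @ [v]"]) (auto simp: graph_path_def)
  qed
  consider "x \<in> V" "y \<in> V" | "x = v" "y = v" | "x \<in> V" "y = v" | "x = v" "y \<in> V"
    using sprout.prems by blast
  then show ?case
  proof cases
    case 1
    then obtain p where "graph_path V E p" "hd p = x" "last p = y"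
      using sprout.IH by blast
    then show ?thesis using graph_path_mono[of V E p ?W ?F] by blast
  next
    case 2
    then show ?thesis by (intro exI[of _ "[v]"]) (auto simp: graph_path_def)
  next
    case 3
    then show ?thesis using new by blast
  next
    case 4
    then obtain p where "graph_path ?W ?F p" "hd p = y" "last p = v"
      using new by blast
    then show ?thesis
      using 4 by (intro exI[of _ "rev p"])
        (auto simp: graph_path_rev hd_rev last_rev graph_path_def path_edges_rev)
  qed
qed

lemma path_crosses_boundary:
  assumes "path_edges p \<subseteq> E" "p \<noteq> []" "hd p \<in> W" "last p \<notin> W"
  shows "\<exists>x y. {x, y} \<in> E \<and> x \<in> W \<and> y \<notin> W"
  using assms
proof (induction p)
  case (Cons x p)
  then show ?case
  proof (cases p)
    case (Cons y q)
    show ?thesis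
    proof (cases "y \<in> W")
      case True
      then show ?thesis using Cons.IH Cons.prems local.Cons by auto
    next
      case False
      then show ?thesis using Cons.prems local.Cons by auto
    qed
  qed auto
qed simp

lemma path_closes_to_cycle:
  assumes "graph_path V E p" "3 \<le> length p" "{last p, hd p} \<in> E"
  shows "graph_cycle V E p"
proof -
  obtain a q where p: "p = a # q" using assms(2) by (cases p) auto
  have "cycle_edges p = insert {last p, hd p} (path_edges p)"
    unfolding p cycle_edges_eq_path_edges using path_edges_snoc[of "a # q" a] by simp
  then show ?thesis
    using assms by (auto simp: graph_path_def graph_cycle_def)
qed

text \<open>Take a grown subgraph with as many vertices as possible. It spans the tree, since by connectedness
  an edge leaves every smaller vertex set, and it contains every edge of the tree, since a further
  edge would close a cycle with the path between its ends.\<close>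

lemma tree_grown:
  assumes tree: "tree V T" and r: "r \<in> V"
  shows "grown r V T"
proof -
  have fin: "finite V" and edges: "\<And>e. e \<in> T \<Longrightarrow> e \<subseteq> V \<and> card e = 2"
    and conn: "connected_graph V T" and acyclic: "\<And>p. \<not> graph_cycle V T p"
    using tree by (auto simp: tree_def simple_graph_def)
  define \<W> where "\<W> = {W. W \<subseteq> V \<and> (\<exists>F \<subseteq> T. grown r W F)}"
  have "\<W> \<subseteq> Pow V" "{r} \<in> \<W>"
    using r grown.root[of r] unfolding \<W>_def by auto
  then have "\<forall>W. W \<in> \<W> \<longrightarrow> card W < Suc (card V)"
    using card_mono[OF fin] by (auto simp: less_Suc_eq_le)
  then obtain W where W: "W \<in> \<W>" and maximal: "\<And>W'. W' \<in> \<W> \<Longrightarrow> card W' \<le> card W"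
    using ex_has_greatest_nat[of "\<lambda>W. W \<in> \<W>", OF \<open>{r} \<in> \<W>\<close>] by blast
  then obtain F where F: "F \<subseteq> T" "grown r W F" and WV: "W \<subseteq> V"
    unfolding \<W>_def by blast
  have "W = V"
  proof (rule ccontr)
    assume "W \<noteq> V"
    then obtain v where v: "v \<in> V" "v \<notin> W" using WV by blast
    obtain p where "graph_path V T p" "hd p = r" "last p = v"
      using conn r v unfolding connected_graph_def by blast
    then obtain x y where xy: "{x, y} \<in> T" "x \<in> W" "y \<notin> W"
      using path_crosses_boundary[of p T W] v grown_finite[OF F(2)] unfolding graph_path_def by blast
    have "grown r (insert y W) (insert {x, y} F)" using grown.sprout[OF F(2)] xy by blast
    moreover have "insert y W \<subseteq> V" using edges xy WV by blast
    ultimately have "insert y W \<in> \<W>" using F xy unfolding \<W>_def by blast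
    from maximal[OF this] show False
      using xy fin WV by (simp add: finite_subset)
  qed
  moreover have "F = T"
  proof (rule ccontr)
    assume "F \<noteq> T"
    then obtain e where e: "e \<in> T" "e \<notin> F" using F by blast
    then obtain x y where xy: "e = {x, y}" "x \<noteq> y" using edges by (metis card_2_iff)
    obtain p where p: "graph_path V F p" "hd p = x" "last p = y"
      using grown_connected[OF F(2)] edges[OF e(1)] xy \<open>W = V\<close> by blast
    have "3 \<le> length p"
    proof (rule ccontr)
      assume "\<not> 3 \<le> length p"
      then consider "p = []" | a where "p = [a]" | a b where "p = [a, b]"
        by (cases p; cases "tl p"; cases "tl (tl p)") auto
      then show False
        using p xy e by cases (auto simp: graph_path_def)
    qed
    moreover have "graph_path V T p" using p(1) F(1) by (auto simp: graph_path_def)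
    ultimately have "graph_cycle V T p"
      using path_closes_to_cycle p e(1) xy by (metis insert_commute)
    then show False using acyclic by blast
  qed
  ultimately show ?thesis using F by simp
qed

text \<open>The recursive description of the distance from the root of a tree, which involves no minimum over
  paths: in the third clause \<open>w\<close> is the parent of \<open>v\<close>.\<close>

definition depth_from :: "'a \<Rightarrow> 'a set \<Rightarrow> 'a set set \<Rightarrow> ('a \<Rightarrow> nat) \<Rightarrow> bool" where
  "depth_from r V E dep \<longleftrightarrow> dep r = 0 \<and>
    (\<forall>x y. {x, y} \<in> E \<longrightarrow> dep x = Suc (dep y) \<or> dep y = Suc (dep x)) \<and>
    (\<forall>v \<in> V. v \<noteq> r \<longrightarrow> (\<exists>!w. {v, w} \<in> E \<and> dep v = Suc (dep w))) \<and>
    (\<forall>v \<in> V. \<exists>p. graph_path V E p \<and> hd p = r \<and> last p = v \<and> length p = Suc (dep v))"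

lemma depth_fromD:
  assumes "depth_from r V E dep"
  shows "dep r = 0"
    and "{x, y} \<in> E \<Longrightarrow> dep x = Suc (dep y) \<or> dep y = Suc (dep x)"
    and "v \<in> V \<Longrightarrow> v \<noteq> r \<Longrightarrow> \<exists>!w. {v, w} \<in> E \<and> dep v = Suc (dep w)"
    and "v \<in> V \<Longrightarrow> \<exists>p. graph_path V E p \<and> hd p = r \<and> last p = v \<and> length p = Suc (dep v)"
  using assms unfolding depth_from_def by simp_all

lemma depth_fromI:
  assumes "dep r = 0"
    and "\<And>x y. {x, y} \<in> E \<Longrightarrow> dep x = Suc (dep y) \<or> dep y = Suc (dep x)"
    and "\<And>v. v \<in> V \<Longrightarrow> v \<noteq> r \<Longrightarrow> \<exists>!w. {v, w} \<in> E \<and> dep v = Suc (dep w)"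
    and "\<And>v. v \<in> V \<Longrightarrow> \<exists>p. graph_path V E p \<and> hd p = r \<and> last p = v \<and> length p = Suc (dep v)"
  shows "depth_from r V E dep"
  unfolding depth_from_def using assms by simp

lemma grown_depth:
  assumes "grown r V E"
  shows "\<exists>dep. depth_from r V E dep"
  using assms
proof (induction rule: grown.induct)
  case root
  have "depth_from r {r} {} (\<lambda>_. 0)"
  proof (rule depth_fromI)
    show "\<exists>p. graph_path {r} {} p \<and> hd p = r \<and> last p = v \<and> length p = Suc 0" if "v \<in> {r}" for v
      using that by (intro exI[of _ "[r]"]) (simp add: graph_path_def)
  qed simp_all
  then show ?case by blast
next
  case (sprout V E u v)
  from sprout.IH obtain dep where "depth_from r V E dep" by blast
  note dep = depth_fromD[OF this]
  have sub: "x \<in> V" "y \<in> V" if "{x, y} \<in> E" for x y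
    using grown_edge_subset[OF sprout.hyps(1) that] by auto
  have r: "r \<in> V" using grown_finite[OF sprout.hyps(1)] by blast
  let ?d = "dep(v := Suc (dep u))"
  have "?d r = 0" using r sprout.hyps dep(1) by auto
  moreover have "?d x = Suc (?d y) \<or> ?d y = Suc (?d x)" if "{x, y} \<in> insert {u, v} E" for x y
    using that dep(2)[of x y] sub[of x y] sprout.hyps(2,3) by (auto simp: doubleton_eq_iff)
  moreover have "\<exists>!w. {x, w} \<in> insert {u, v} E \<and> ?d x = Suc (?d w)"
    if x: "x \<in> insert v V" "x \<noteq> r" for x
  proof (cases "x = v")
    case True
    show ?thesis
    proof (rule ex1I[of _ u])
      show "w = u" if "{x, w} \<in> insert {u, v} E \<and> ?d x = Suc (?d w)" for w
        using that True sub[of v w] sprout.hyps(3) by (auto simp: doubleton_eq_iff)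
    qed (use True sprout.hyps in \<open>auto simp: insert_commute\<close>)
  next
    case False
    then obtain w where w: "{x, w} \<in> E" "dep x = Suc (dep w)"
      and uniq: "\<And>w'. {x, w'} \<in> E \<Longrightarrow> dep x = Suc (dep w') \<Longrightarrow> w' = w"
      using dep(3)[of x] x by blast
    show ?thesis
    proof (rule ex1I[of _ w])
      show "{x, w} \<in> insert {u, v} E \<and> ?d x = Suc (?d w)"
        using w sub[OF w(1)] sprout.hyps(3) False by auto
      show "w' = w" if w': "{x, w'} \<in> insert {u, v} E \<and> ?d x = Suc (?d w')" for w'
      proof (cases "{x, w'} \<in> E")
        case True
        then show ?thesis using uniq w' sub[OF True] sprout.hyps(3) \<open>x \<noteq> v\<close>
          by (auto split: if_splits)
      next
        case False': False
        then have "x = u" "w' = v" using w' False by (auto simp: doubleton_eq_iff)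
        then show ?thesis using w' False by auto
      qed
    qed
  qed
  moreover have "\<exists>p. graph_path (insert v V) (insert {u, v} E) p \<and> hd p = r \<and> last p = x \<and>
      length p = Suc (?d x)" if x: "x \<in> insert v V" for x
  proof (cases "x = v")
    case True
    obtain p where p: "graph_path V E p" "hd p = r" "last p = u" "length p = Suc (dep u)"
      using dep(4)[OF sprout.hyps(2)] by blast
    show ?thesis
      using graph_path_snoc[OF p(1) sprout.hyps(3)] p True
      by (intro exI[of _ "p @ [v]"]) (auto simp: graph_path_def)
  next
    case False
    then obtain p where "graph_path V E p" "hd p = r" "last p = x" "length p = Suc (dep x)"
      using dep(4)[of x] x by blast
    then show ?thesis
      using False graph_path_mono[of V E p "insert v V" "insert {u, v} E"] by (intro exI[of _ p]) auto
  qed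
  ultimately have "depth_from r (insert v V) (insert {u, v} E) ?d"
    by (intro depth_fromI) simp_all
  then show ?case by blast
qed

lemma depth_bounded_by_path_length:
  fixes dep :: "'a \<Rightarrow> nat"
  assumes "\<And>x y. {x, y} \<in> E \<Longrightarrow> dep x = Suc (dep y) \<or> dep y = Suc (dep x)"
    and "p \<noteq> []" "path_edges p \<subseteq> E"
  shows "dep (last p) + 1 \<le> dep (hd p) + length p"
  using assms(2,3)
proof (induction p)
  case (Cons x p)
  then show ?case
  proof (cases p)
    case (Cons y q)
    then have "dep y \<le> Suc (dep x)" using Cons.prems assms(1)[of x y] by auto
    then show ?thesis using Cons.IH Cons.prems local.Cons by auto
  qed auto
qed simp

text \<open>The depth defined along the growth of the tree is the distance from \<open>r\<close>: it is attained by some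
  path, and it changes by one along every edge, so that no path can be shorter.\<close>

lemma tree_depth:
  assumes tree: "tree V T" and r: "r \<in> V"
  shows "graph_dist V T r r = 0"
    and "{x, y} \<in> T \<Longrightarrow>
      graph_dist V T r x = Suc (graph_dist V T r y) \<or> graph_dist V T r y = Suc (graph_dist V T r x)"
    and "v \<in> V \<Longrightarrow> v \<noteq> r \<Longrightarrow> \<exists>!w. {v, w} \<in> T \<and> graph_dist V T r v = Suc (graph_dist V T r w)"
proof -
  obtain dep where "depth_from r V T dep"
    using grown_depth[OF tree_grown[OF tree r]] by blast
  note dep = depth_fromD[OF this]
  have dist: "graph_dist V T r v = dep v" if "v \<in> V" for v
    unfolding graph_dist_def
  proof (rule Least_equality)
    show "dep v \<le> n" if "\<exists>p. graph_path V T p \<and> hd p = r \<and> last p = v \<and> length p = Suc n" for n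
      using that depth_bounded_by_path_length[of T dep] dep(1,2) by (fastforce simp: graph_path_def)
  qed (use dep(4)[OF that] in blast)
  have sub: "x \<in> V" "y \<in> V" if "{x, y} \<in> T" for x y
    using tree that unfolding tree_def simple_graph_def by blast+
  show "graph_dist V T r r = 0" using dist[OF r] dep(1) by simp
  show "graph_dist V T r x = Suc (graph_dist V T r y) \<or> graph_dist V T r y = Suc (graph_dist V T r x)"
    if "{x, y} \<in> T"
    using dep(2)[OF that] sub[OF that] dist by simp
  show "\<exists>!w. {v, w} \<in> T \<and> graph_dist V T r v = Suc (graph_dist V T r w)"
    if v: "v \<in> V" "v \<noteq> r"
    using dep(3)[OF v] dist[OF v(1)] dist sub by metis
qed


section \<open>Coloring a tree\<close>

text \<open>Here \<open>\<sigma> v\<close> is the cyclic list of \<open>D\<close> colors at \<open>v\<close>. The second clause applies to an edge in both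
  directions: the colors that the lists of its ends share lie in the arc of half a turn that starts
  at the color of the edge.\<close>

definition star_palette :: "nat \<Rightarrow> 'a set \<Rightarrow> 'a set set \<Rightarrow> ('a set \<Rightarrow> nat) \<Rightarrow> ('a \<Rightarrow> nat \<Rightarrow> nat) \<Rightarrow> bool" where
  "star_palette D V E c \<sigma> \<longleftrightarrow>
     (\<forall>v \<in> V. inj_on (\<sigma> v) {..<D} \<and> \<sigma> v ` {..<D} \<subseteq> {..<3 * D div 2}) \<and>
     (\<forall>v w. {v, w} \<in> E \<longrightarrow> (\<exists>i<D. c {v, w} = \<sigma> v i \<and>
        \<sigma> v ` {..<D} \<inter> \<sigma> w ` {..<D} \<subseteq> (\<lambda>t. \<sigma> v ((i + t) mod D)) ` {..(D - 1) div 2})) \<and>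
     (\<forall>e \<in> E. \<forall>f \<in> E. e \<noteq> f \<longrightarrow> e \<inter> f \<noteq> {} \<longrightarrow> c e \<noteq> c f)"

lemma star_paletteD:
  assumes "star_palette D V E c \<sigma>"
  shows "v \<in> V \<Longrightarrow> inj_on (\<sigma> v) {..<D}"
    and "v \<in> V \<Longrightarrow> \<sigma> v ` {..<D} \<subseteq> {..<3 * D div 2}"
    and "{v, w} \<in> E \<Longrightarrow> \<exists>i<D. c {v, w} = \<sigma> v i \<and>
        \<sigma> v ` {..<D} \<inter> \<sigma> w ` {..<D} \<subseteq> (\<lambda>t. \<sigma> v ((i + t) mod D)) ` {..(D - 1) div 2}"
    and "e \<in> E \<Longrightarrow> f \<in> E \<Longrightarrow> e \<noteq> f \<Longrightarrow> e \<inter> f \<noteq> {} \<Longrightarrow> c e \<noteq> c f"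
  using assms unfolding star_palette_def by simp_all

text \<open>The list \<open>s'\<close> for a new neighbour starts with the color at position \<open>i\<close> of \<open>s\<close>, goes on with the next
  \<open>(D - 1) div 2\<close> colors of \<open>s\<close> and ends with all colors outside \<open>s\<close>. The latter are \<open>D div 2\<close> in number,
  which is just what is missing to the length \<open>D\<close>.\<close>

lemma new_palette:
  fixes s :: "nat \<Rightarrow> nat"
  assumes s: "inj_on s {..<D}" "s ` {..<D} \<subseteq> {..<3 * D div 2}" and i: "i < D"
  obtains s' :: "nat \<Rightarrow> nat" where "inj_on s' {..<D}" "s' ` {..<D} \<subseteq> {..<3 * D div 2}" "s' 0 = s i"
    "s ` {..<D} \<inter> s' ` {..<D} \<subseteq> (\<lambda>t. s ((i + t) mod D)) ` {..(D - 1) div 2}"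
    "s ` {..<D} \<inter> s' ` {..<D} \<subseteq> s' ` {..(D - 1) div 2}"
proof -
  let ?h = "(D - 1) div 2"
  let ?out = "{..<3 * D div 2} - s ` {..<D}"
  have h: "?h < D" using i by auto
  have "card ?out = 3 * D div 2 - D"
    using s by (subst card_Diff_subset) (auto simp: card_image)
  then have "card {?h<..<D} = card ?out" using i by simp
  then obtain g where g: "bij_betw g {?h<..<D} ?out"
    using finite_same_card_bij[of "{?h<..<D}" ?out] by auto
  define s' where "s' t = (if t \<le> ?h then s ((i + t) mod D) else g t)" for t
  have low: "s' ` {..?h} = (\<lambda>t. s ((i + t) mod D)) ` {..?h}"
    by (intro image_cong) (auto simp: s'_def)
  have high: "s' ` {?h<..<D} = ?out"
    using g by (auto simp: s'_def bij_betw_def image_def)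
  have split: "{..<D} = {..?h} \<union> {?h<..<D}" using h by auto
  have inside: "s' ` {..?h} \<subseteq> s ` {..<D}"
    unfolding low using i by auto
  have "inj_on s' {..?h}"
  proof (rule inj_onI)
    fix a b assume ab: "a \<in> {..?h}" "b \<in> {..?h}" "s' a = s' b"
    then have "s ((i + a) mod D) = s ((i + b) mod D)" by (simp add: s'_def)
    then have "(i + a) mod D = (i + b) mod D"
      using s(1) i by (auto dest: inj_onD)
    moreover have "(i + x) mod D = (if i + x < D then i + x else i + x - D)" if "x < D" for x
      using that i by (simp add: le_mod_geq)
    moreover have "a < D" "b < D" using ab(1,2) h by simp_all
    ultimately show "a = b" by (simp split: if_splits)
  qed
  moreover have "inj_on s' {?h<..<D}"
    using g by (auto simp: bij_betw_def inj_on_def s'_def)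
  ultimately have "inj_on s' {..<D}"
    unfolding split using inside high by (subst inj_on_Un) auto
  moreover have "s' ` {..<D} \<subseteq> {..<3 * D div 2}"
    unfolding split image_Un using inside high s(2) by auto
  moreover have "s' 0 = s i" using i by (simp add: s'_def)
  moreover have "s ` {..<D} \<inter> s' ` {..<D} \<subseteq> s' ` {..?h}"
    unfolding split image_Un using high by auto
  ultimately show ?thesis using that[of s'] low by simp
qed

lemma degree_insert_edge:
  assumes "finite E" "e \<notin> E"
  shows "degree (insert e E) v = degree E v + (if v \<in> e then 1 else 0)"
proof -
  have "{f \<in> insert e E. v \<in> f} = (if v \<in> e then insert e {f \<in> E. v \<in> f} else {f \<in> E. v \<in> f})"
    by auto
  then show ?thesis using assms by (simp add: degree_def)
qed

text \<open>When \<open>v\<close> is hung on \<open>u\<close>, fewer than \<open>D\<close> edges are present at \<open>u\<close>, so some color in the list of \<open>u\<close> is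
  free for the new edge.\<close>

lemma star_palette_exists:
  assumes "grown r V E" "\<And>v. v \<in> V \<Longrightarrow> degree E v \<le> D" "0 < D"
  shows "\<exists>c \<sigma>. star_palette D V E c \<sigma>"
  using assms
proof (induction rule: grown.induct)
  case root
  have "star_palette D {r} {} (\<lambda>_. 0) (\<lambda>_ t. t)"
    by (auto simp: star_palette_def)
  then show ?case by blast
next
  case (sprout V E u v)
  let ?e = "{u, v}"
  have sub: "e \<subseteq> V" if "e \<in> E" for e using grown_edge_subset[OF sprout.hyps(1) that] .
  have fin: "finite E" and notin: "?e \<notin> E"
    using grown_finite[OF sprout.hyps(1)] sub sprout.hyps(3) by auto
  have deg: "degree E w + (if w \<in> ?e then 1 else 0) \<le> D" if "w \<in> V" for w
    using sprout.prems(1)[of w] that degree_insert_edge[OF fin notin, of w] by auto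
  obtain c \<sigma> where pal: "star_palette D V E c \<sigma>"
    using sprout.IH sprout.prems(2) deg by (metis add_leD1)
  have u: "inj_on (\<sigma> u) {..<D}" "\<sigma> u ` {..<D} \<subseteq> {..<3 * D div 2}"
    using star_paletteD(1,2)[OF pal sprout.hyps(2)] .
  let ?used = "c ` {e \<in> E. u \<in> e}"
  have "card ?used \<le> degree E u" unfolding degree_def by (rule card_image_le) (simp add: fin)
  also have "\<dots> < D" using deg[OF sprout.hyps(2)] by simp
  also have "D = card (\<sigma> u ` {..<D})" using u by (simp add: card_image)
  finally have "\<not> \<sigma> u ` {..<D} \<subseteq> ?used"
    using card_mono[of ?used "\<sigma> u ` {..<D}"] fin by auto
  then obtain i where i: "i < D" "\<sigma> u i \<notin> ?used" by auto
  obtain s where s: "inj_on s {..<D}" "s ` {..<D} \<subseteq> {..<3 * D div 2}" "s 0 = \<sigma> u i"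
    "\<sigma> u ` {..<D} \<inter> s ` {..<D} \<subseteq> (\<lambda>t. \<sigma> u ((i + t) mod D)) ` {..(D - 1) div 2}"
    "\<sigma> u ` {..<D} \<inter> s ` {..<D} \<subseteq> s ` {..(D - 1) div 2}"
    using new_palette[OF u i(1)] by blast
  let ?c = "c(?e := \<sigma> u i)" and ?\<sigma> = "\<sigma>(v := s)"
  have v: "v \<noteq> u" using sprout.hyps by auto
  have "star_palette D (insert v V) (insert ?e E) ?c ?\<sigma>"
    unfolding star_palette_def
  proof (intro conjI)
    show "\<forall>w\<in>insert v V. inj_on (?\<sigma> w) {..<D} \<and> ?\<sigma> w ` {..<D} \<subseteq> {..<3 * D div 2}"
      using star_paletteD(1,2)[OF pal] s(1,2) by simp
    show "\<forall>e\<in>insert ?e E. \<forall>f\<in>insert ?e E. e \<noteq> f \<longrightarrow> e \<inter> f \<noteq> {} \<longrightarrow> ?c e \<noteq> ?c f"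
    proof (intro ballI impI)
      have new: "c f \<noteq> \<sigma> u i" if "f \<in> E" "?e \<inter> f \<noteq> {}" for f
        using that i(2) sub[OF that(1)] sprout.hyps(3) by (auto simp: image_iff)
      have old: "c e \<noteq> c f" if "e \<in> E" "f \<in> E" "e \<noteq> f" "e \<inter> f \<noteq> {}" for e f
        using star_paletteD(4)[OF pal that] .
      fix e f assume ef: "e \<in> insert ?e E" "f \<in> insert ?e E" "e \<noteq> f" "e \<inter> f \<noteq> {}"
      then consider "e = ?e" "f \<noteq> ?e" "f \<in> E" | "f = ?e" "e \<noteq> ?e" "e \<in> E"
        | "e \<noteq> ?e" "f \<noteq> ?e" "e \<in> E" "f \<in> E" by blast
      then show "?c e \<noteq> ?c f"
      proof cases
        case 1
        then show ?thesis using new[of f] ef(4) by (simp only: fun_upd_apply) auto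
      next
        case 2
        then show ?thesis using new[of e] ef(4) by (simp only: fun_upd_apply Int_commute) auto
      next
        case 3
        then show ?thesis using old[of e f] ef(3,4) by (simp only: fun_upd_apply) simp
      qed
    qed
    have "\<exists>i'<D. ?c {x, y} = ?\<sigma> x i' \<and> ?\<sigma> x ` {..<D} \<inter> ?\<sigma> y ` {..<D}
        \<subseteq> (\<lambda>t. ?\<sigma> x ((i' + t) mod D)) ` {..(D - 1) div 2}"
      if xy: "{x, y} \<in> insert ?e E" for x y
    proof -
      consider "{x, y} \<in> E" | "x = u" "y = v" | "x = v" "y = u"
        using xy by (auto simp: doubleton_eq_iff)
      then show ?thesis
      proof cases
        case 1
        then have "{x, y} \<noteq> ?e" "x \<noteq> v" "y \<noteq> v" using notin sub[OF 1] sprout.hyps(3) by auto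
        then show ?thesis using star_paletteD(3)[OF pal 1] by simp
      next
        case 2
        then show ?thesis using s(4) i(1) v by (intro exI[of _ i]) simp
      next
        \<comment> \<open>Seen from the new vertex, the edge has position 0, so the shared arc is an initial segment.\<close>
        case 3
        have "(\<lambda>t. s ((0 + t) mod D)) ` {..(D - 1) div 2} = s ` {..(D - 1) div 2}"
          using i(1) by (intro image_cong) auto
        then show ?thesis
          using 3 s(3,5) i(1) v by (intro exI[of _ 0]) (auto simp: insert_commute)
      qed
    qed
    then show "\<forall>x y. {x, y} \<in> insert ?e E \<longrightarrow> (\<exists>i'<D. ?c {x, y} = ?\<sigma> x i' \<and>
        ?\<sigma> x ` {..<D} \<inter> ?\<sigma> y ` {..<D} \<subseteq> (\<lambda>t. ?\<sigma> x ((i' + t) mod D)) ` {..(D - 1) div 2})"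
      by blast
  qed
  then show ?case by blast
qed

text \<open>Going \<open>t\<close> steps from \<open>i\<close> to \<open>k\<close> and \<open>t'\<close> steps back to \<open>i\<close> amounts to a multiple of \<open>D\<close>, but
  \<open>t + t' < D\<close>. So ``at most half a turn ahead'' is a tournament on the positions.\<close>

lemma circular_tournament:
  fixes D :: nat
  assumes "t \<le> (D - 1) div 2" "t' \<le> (D - 1) div 2" "i < D" "k < D"
    and "k = (i + t) mod D" "i = (k + t') mod D"
  shows "i = k"
proof -
  have "(i + (t + t')) mod D = i mod D"
    using assms(3,5,6) by (metis add.assoc mod_add_left_eq mod_less)
  then have "D dvd t + t'"
    by (metis add.commute add_diff_cancel_right' dvd_refl mod_eq_dvd_iff_nat le_add1 mod_eq_dvd_iff_nat)
  moreover have "t + t' < D" using assms(1-3) by auto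
  ultimately have "t = 0" by (auto dest: dvd_imp_le)
  then show ?thesis using assms(3,5) by simp
qed

text \<open>In a bicolored walk, the color of either edge at the middle vertex \<open>x3\<close> also occurs at the far end
  of the other edge. Hence, in the list of \<open>x3\<close>, each of the two colors is at most half a turn
  ahead of the other.\<close>

lemma star_palette_no_bicolored_walk:
  assumes pal: "star_palette D V E c \<sigma>" and sub: "\<And>e. e \<in> E \<Longrightarrow> e \<subseteq> V"
  shows "no_bicolored_walk E c"
  unfolding no_bicolored_walk_def
proof (intro allI impI notI)
  fix x1 x2 x3 x4 x5
  assume e: "{x1, x2} \<in> E" "{x2, x3} \<in> E" "{x3, x4} \<in> E" "{x4, x5} \<in> E" and "x2 \<noteq> x4"
    and col: "c {x1, x2} = c {x3, x4}" "c {x2, x3} = c {x4, x5}"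
  have inj: "inj_on (\<sigma> x3) {..<D}"
    using star_paletteD(1)[OF pal] sub[OF e(2)] by simp
  have palette: "\<exists>i<D. c {v, w} = \<sigma> v i \<and> \<sigma> v ` {..<D} \<inter> \<sigma> w ` {..<D}
      \<subseteq> (\<lambda>t. \<sigma> v ((i + t) mod D)) ` {..(D - 1) div 2}" if "{v, w} \<in> E" for v w
    using star_paletteD(3)[OF pal that] .
  have mem: "c {v, w} \<in> \<sigma> v ` {..<D}" if "{v, w} \<in> E" for v w
    using palette[OF that] by auto
  obtain i where i: "i < D" "c {x2, x3} = \<sigma> x3 i" "\<sigma> x3 ` {..<D} \<inter> \<sigma> x2 ` {..<D}
      \<subseteq> (\<lambda>t. \<sigma> x3 ((i + t) mod D)) ` {..(D - 1) div 2}"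
    using palette[of x3 x2] e(2) by (auto simp: insert_commute)
  obtain k where k: "k < D" "c {x3, x4} = \<sigma> x3 k" "\<sigma> x3 ` {..<D} \<inter> \<sigma> x4 ` {..<D}
      \<subseteq> (\<lambda>t. \<sigma> x3 ((k + t) mod D)) ` {..(D - 1) div 2}"
    using palette[OF e(3)] by auto
  have "c {x3, x4} \<in> \<sigma> x3 ` {..<D} \<inter> \<sigma> x2 ` {..<D}"
    using mem[OF e(3)] mem[of x2 x1] e(1) col(1) by (simp add: insert_commute)
  then obtain t where t: "t \<le> (D - 1) div 2" "\<sigma> x3 k = \<sigma> x3 ((i + t) mod D)"
    using i(3) k(2) by auto
  have "c {x2, x3} \<in> \<sigma> x3 ` {..<D} \<inter> \<sigma> x4 ` {..<D}"
    using mem[of x3 x2] mem[OF e(4)] e(2) col(2) by (simp add: insert_commute)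
  then obtain t' where t': "t' \<le> (D - 1) div 2" "\<sigma> x3 i = \<sigma> x3 ((k + t') mod D)"
    using k(3) i(2) by auto
  have "k = (i + t) mod D" by (rule inj_onD[OF inj t(2)]) (use i(1) k(1) in simp_all)
  moreover have "i = (k + t') mod D" by (rule inj_onD[OF inj t'(2)]) (use i(1) k(1) in simp_all)
  ultimately have "i = k" using circular_tournament t(1) t'(1) i(1) k(1) by blast
  then have "c {x2, x3} = c {x3, x4}" using i(2) k(2) by simp
  moreover have "{x2, x3} \<noteq> {x3, x4}" using \<open>x2 \<noteq> x4\<close> by (auto simp: doubleton_eq_iff)
  ultimately show False
    using star_paletteD(4)[OF pal e(2,3)] by blast
qed

lemma tree_star_coloring:
  assumes tree: "tree V T" and deg: "\<And>v. v \<in> V \<Longrightarrow> degree T v \<le> D" and D: "0 < D"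
  obtains c where "proper_edge_coloring T (3 * D div 2) c" "no_bicolored_walk T c"
proof -
  have sub: "e \<subseteq> V" and two: "card e = 2" if "e \<in> T" for e
    using tree that by (auto simp: tree_def simple_graph_def)
  obtain r where r: "r \<in> V"
    using tree unfolding tree_def connected_graph_def by blast
  obtain c \<sigma> where pal: "star_palette D V T c \<sigma>"
    using star_palette_exists[OF tree_grown[OF tree r] deg D] by blast
  have "c e < 3 * D div 2" if "e \<in> T" for e
  proof -
    have "\<exists>x y. e = {x, y}" using two[OF that] by (auto simp: card_2_iff)
    then obtain x y where xy: "e = {x, y}" by blast
    have "\<exists>i<D. c e = \<sigma> x i"
      using star_paletteD(3)[OF pal, of x y] that unfolding xy by blast
    then obtain i where "i < D" "c e = \<sigma> x i" by blast
    moreover have "\<sigma> x ` {..<D} \<subseteq> {..<3 * D div 2}"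
      using star_paletteD(2)[OF pal] sub[OF that] xy by simp
    ultimately show ?thesis by auto
  qed
  then have "proper_edge_coloring T (3 * D div 2) c"
    using star_paletteD(4)[OF pal] unfolding proper_edge_coloring_def by auto
  then show ?thesis using that star_palette_no_bicolored_walk[OF pal sub] by blast
qed


section \<open>Crossing arcs in a disc\<close>

text \<open>The chord \<open>c\<close> divides the disc bounded by \<open>c1\<close> and \<open>c2\<close> into two discs. Their closures cover the
  disc and meet only in points of the chord, so a connected set that avoids the chord lies in one of
  them and cannot reach both \<open>c1\<close> and \<open>c2\<close>.\<close>

lemma connected_set_misses_chord:
  fixes c c1 c2 :: "real \<Rightarrow> complex"
  assumes c1: "arc c1" "pathstart c1 = a" "pathfinish c1 = b"
    and c2: "arc c2" "pathstart c2 = a" "pathfinish c2 = b"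
    and c: "arc c" "pathstart c = a" "pathfinish c = b"
    and c1c2: "path_image c1 \<inter> path_image c2 = {a, b}"
    and c1c: "path_image c1 \<inter> path_image c = {a, b}"
    and c2c: "path_image c2 \<inter> path_image c = {a, b}"
    and chord: "path_image c \<inter> inside (path_image c1 \<union> path_image c2) \<noteq> {}"
    and B: "connected B" "B \<inter> path_image c = {}"
      "B \<subseteq> path_image c1 \<union> path_image c2 \<union> inside (path_image c1 \<union> path_image c2)"
      "B \<inter> path_image c1 \<noteq> {}" "B \<inter> path_image c2 \<noteq> {}"
  shows False
proof -
  let ?I1 = "inside (path_image c1 \<union> path_image c)" and ?I2 = "inside (path_image c2 \<union> path_image c)"
  let ?I = "inside (path_image c1 \<union> path_image c2)"
  have ab: "a \<noteq> b" using arc_distinct_ends[OF c1(1)] c1 by simp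
  have disj: "?I1 \<inter> ?I2 = {}" and union: "?I1 \<union> ?I2 \<union> (path_image c - {a, b}) = ?I"
    using split_inside_simple_closed_curve[of c1 a b c2 c] c1 c2 c c1c2 c1c c2c chord ab
    by (metis arc_imp_simple_path)+
  have closed: "closed (path_image g \<union> path_image c \<union> inside (path_image g \<union> path_image c))"
    if "arc g" for g
  proof -
    have "closed (path_image g \<union> path_image c)"
      using that c(1) by (simp add: arc_imp_path closed_path_image closed_Un)
    then show ?thesis
      by (simp add: union_with_inside open_outside closed_Compl)
  qed
  let ?F1 = "path_image c1 \<union> path_image c \<union> ?I1" and ?F2 = "path_image c2 \<union> path_image c \<union> ?I2"
  have "B \<subseteq> ?F1 \<union> ?F2" using B(3) union by blast
  moreover have "?F1 \<inter> ?F2 \<inter> B = {}"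
  proof -
    have "?I \<inter> (path_image c1 \<union> path_image c2) = {}" by (rule inside_no_overlap)
    then have "?I1 \<inter> path_image c2 = {}" "?I2 \<inter> path_image c1 = {}" using union by blast+
    then show ?thesis using disj c1c2 c1c B(2) by blast
  qed
  moreover have "?F1 \<inter> B \<noteq> {}" "?F2 \<inter> B \<noteq> {}" using B(4,5) by blast+
  ultimately show False
    using B(1) closed[OF c1(1)] closed[OF c2(1)] unfolding connected_closed by blast
qed


section \<open>Arcs along paths of a plane graph\<close>

lemma plane_embeddingD:
  assumes "plane_embedding V E pos \<gamma>"
  shows "inj_on pos V"
    and "e \<in> E \<Longrightarrow> arc (\<gamma> e)"
    and "e \<in> E \<Longrightarrow> {pathstart (\<gamma> e), pathfinish (\<gamma> e)} = pos ` e"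
    and "e \<in> E \<Longrightarrow> f \<in> E \<Longrightarrow> e \<noteq> f \<Longrightarrow> path_image (\<gamma> e) \<inter> path_image (\<gamma> f) = pos ` (e \<inter> f)"
  using assms unfolding plane_embedding_def by simp_all

lemma vertex_on_edge:
  assumes "plane_embedding V E pos \<gamma>" "e \<in> E" "v \<in> e"
  shows "pos v \<in> path_image (\<gamma> e)"
proof -
  have "pos v \<in> {pathstart (\<gamma> e), pathfinish (\<gamma> e)}"
    using plane_embeddingD(3)[OF assms(1,2)] assms(3) by simp
  then show ?thesis
    using pathstart_in_path_image[of "\<gamma> e"] pathfinish_in_path_image[of "\<gamma> e"] by auto
qed

lemma edge_arc:
  assumes emb: "plane_embedding V E pos \<gamma>" and e: "{x, y} \<in> E"
  obtains g where "arc g" "pathstart g = pos x" "pathfinish g = pos y"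
    "path_image g = path_image (\<gamma> {x, y})"
proof -
  note e' = plane_embeddingD(2,3)[OF emb e]
  consider "pathstart (\<gamma> {x, y}) = pos x" "pathfinish (\<gamma> {x, y}) = pos y"
    | "pathstart (\<gamma> {x, y}) = pos y" "pathfinish (\<gamma> {x, y}) = pos x"
    using e'(2) by (auto simp: doubleton_eq_iff)
  then show ?thesis
  proof cases
    case 1
    then show ?thesis using that e'(1) by blast
  next
    case 2
    then show ?thesis using that[of "reversepath (\<gamma> {x, y})"] e'(1) by (simp add: arc_reversepath)
  qed
qed

text \<open>A path of the graph is drawn as an arc: consecutive edge arcs are concatenated, and they meet
  only in the common vertex since the vertices of the path are distinct.\<close>

lemma path_arc:
  assumes emb: "plane_embedding V E pos \<gamma>"
    and p: "distinct p" "path_edges p \<subseteq> E" "2 \<le> length p"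
  obtains g where "arc g" "pathstart g = pos (hd p)" "pathfinish g = pos (last p)"
    "path_image g = (\<Union>e \<in> path_edges p. path_image (\<gamma> e))"
proof -
  have "\<exists>g. arc g \<and> pathstart g = pos (hd p) \<and> pathfinish g = pos (last p) \<and>
      path_image g = (\<Union>e \<in> path_edges p. path_image (\<gamma> e))"
    using p
  proof (induction p)
    case (Cons x p)
    from Cons.prems obtain y q where p: "p = y # q" by (cases p) auto
    have xy: "{x, y} \<in> E" using Cons.prems p by simp
    obtain g where g: "arc g" "pathstart g = pos x" "pathfinish g = pos y"
      "path_image g = path_image (\<gamma> {x, y})"
      using edge_arc[OF emb xy] .
    show ?case
    proof (cases q)
      case Nil
      then show ?thesis using g p by (intro exI[of _ g]) simp
    next
      case q: (Cons z q')
      obtain g' where g': "arc g'" "pathstart g' = pos y" "pathfinish g' = pos (last p)"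
        "path_image g' = (\<Union>e \<in> path_edges p. path_image (\<gamma> e))"
        using Cons p q by auto
      have "path_image g \<inter> path_image (\<gamma> f) \<subseteq> {pos y}" if f: "f \<in> path_edges p" for f
      proof -
        have "x \<notin> f" using path_edge_subset[OF f] Cons.prems by auto
        then have "{x, y} \<noteq> f" "{x, y} \<inter> f \<subseteq> {y}" by auto
        moreover have "f \<in> E" using f Cons.prems p by auto
        ultimately show ?thesis
          using plane_embeddingD(4)[OF emb xy] g(4) by auto
      qed
      then have "path_image g \<inter> path_image g' \<subseteq> {pos y}" using g'(4) by blast
      then have "arc (g +++ g')" using g g' by (intro arc_join) auto
      moreover have "path_image (g +++ g') = path_image g \<union> path_image g'"
        using g g' by (simp add: path_image_join)
      ultimately show ?thesis
        using g g' p by (intro exI[of _ "g +++ g'"]) simp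
    qed
  qed simp
  then show ?thesis using that by blast
qed

lemma edge_images_Int:
  assumes emb: "plane_embedding V E pos \<gamma>" and AB: "A \<subseteq> E" "B \<subseteq> E" "A \<inter> B = {}"
    and sub: "\<Union> A \<subseteq> V" "\<Union> B \<subseteq> V"
  shows "(\<Union>e \<in> A. path_image (\<gamma> e)) \<inter> (\<Union>e \<in> B. path_image (\<gamma> e)) = pos ` (\<Union> A \<inter> \<Union> B)"
proof
  show "(\<Union>e \<in> A. path_image (\<gamma> e)) \<inter> (\<Union>e \<in> B. path_image (\<gamma> e)) \<subseteq> pos ` (\<Union> A \<inter> \<Union> B)"
  proof
    fix z assume "z \<in> (\<Union>e \<in> A. path_image (\<gamma> e)) \<inter> (\<Union>e \<in> B. path_image (\<gamma> e))"
    then obtain e f where ef: "e \<in> A" "f \<in> B" "z \<in> path_image (\<gamma> e) \<inter> path_image (\<gamma> f)" by blast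
    then have "z \<in> pos ` (e \<inter> f)"
      using plane_embeddingD(4)[OF emb, of e f] AB by blast
    then show "z \<in> pos ` (\<Union> A \<inter> \<Union> B)" using ef by blast
  qed
  show "pos ` (\<Union> A \<inter> \<Union> B) \<subseteq> (\<Union>e \<in> A. path_image (\<gamma> e)) \<inter> (\<Union>e \<in> B. path_image (\<gamma> e))"
  proof
    fix z assume "z \<in> pos ` (\<Union> A \<inter> \<Union> B)"
    then obtain v e f where v: "z = pos v" "v \<in> e" "e \<in> A" "v \<in> f" "f \<in> B" by blast
    then show "z \<in> (\<Union>e \<in> A. path_image (\<gamma> e)) \<inter> (\<Union>e \<in> B. path_image (\<gamma> e))"
      using v AB vertex_on_edge[OF emb] by blast
  qed
qed

section \<open>Chords of the adjoint cycle\<close>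

text \<open>The frontier \<open>G\<close> of the exterior face determines this face: \<open>outside G\<close> is connected, contains the
  exterior face and avoids its frontier, so it is the exterior face. Everything drawn therefore lies
  on or inside \<open>G\<close>.\<close>

lemma drawing_within_boundary:
  fixes D G :: "complex set"
  assumes "compact D" and G: "G \<subseteq> D" "compact G" and front: "frontier (outside D) = G"
  shows "D \<subseteq> G \<union> inside G"
proof -
  have sub: "outside D \<subseteq> outside G" by (rule outside_mono[OF G(1)])
  have "connected (outside G)"
    using G(2) by (intro connected_outside) (auto simp: compact_imp_bounded)
  moreover have "outside D \<noteq> {}"
    using assms(1) by (intro outside_bounded_nonempty compact_imp_bounded)
  moreover have "outside G \<inter> frontier (outside D) = {}"
    using front outside_no_overlap[of G] by blast
  ultimately have "outside G \<subseteq> outside D"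
    using connected_Int_frontier[of "outside G" "outside D"] sub by blast
  moreover have "D \<inter> outside D = {}" using outside_no_overlap[of D] by blast
  ultimately show ?thesis using union_with_inside[of G] by blast
qed

lemma inner_edge_meets_path:
  assumes "xs \<noteq> []" "e \<in> path_edges (a # xs @ [b])"
  shows "e \<inter> set xs \<noteq> {}"
proof -
  obtain i where i: "Suc i < length (a # xs @ [b])"
    "e = {(a # xs @ [b]) ! i, (a # xs @ [b]) ! Suc i}"
    using assms(2) unfolding path_edges_def by blast
  show ?thesis
  proof (cases i)
    case 0
    then show ?thesis using i assms(1) by (cases xs) auto
  next
    case (Suc j)
    then have "(a # xs @ [b]) ! i = xs ! j" "j < length xs" using i by (auto simp: nth_append)
    then show ?thesis using i(2) by auto
  qed
qed

text \<open>The leaves \<open>a\<close> and \<open>b\<close> divide the adjoint cycle into the arcs through \<open>xs\<close> and through \<open>ys\<close>, and the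
  edges from \<open>u\<close> to \<open>a\<close> and to \<open>b\<close> form a chord. The path \<open>q\<close> would be a connected set inside the
  disc that joins the two arcs without meeting the chord.\<close>

lemma halin_noncrossing:
  assumes halin: "halin_graph V T C pos \<gamma>"
    and cyc: "distinct (a # xs @ b # ys)" "cycle_edges (a # xs @ b # ys) = C"
      "set (a # xs @ b # ys) = leaves V T"
    and u: "{a, u} \<in> T" "{b, u} \<in> T" "u \<notin> leaves V T"
    and q: "graph_path V T q" "hd q \<in> set xs" "last q \<in> set ys" "u \<notin> set q" "a \<notin> set q" "b \<notin> set q"
  shows False
proof -
  let ?E = "T \<union> C"
  define img where "img A = (\<Union>e \<in> A. path_image (\<gamma> e))" for A
  have emb: "plane_embedding V ?E pos \<gamma>" and tree: "tree V T"
    and front: "frontier (outside (drawing V ?E pos \<gamma>)) = img C"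
    using halin unfolding halin_graph_def exterior_face_def img_def by blast+
  have T_sub: "e \<subseteq> V" if "e \<in> T" for e
    using tree that unfolding tree_def simple_graph_def by blast
  have L_sub: "leaves V T \<subseteq> V" by (auto simp: leaves_def)
  have uV: "u \<in> V" using T_sub[OF u(1)] by simp
  have ne: "xs \<noteq> []" "ys \<noteq> []" using q by auto
  have au: "a \<noteq> u" "b \<noteq> u" using u cyc by auto
  let ?p1 = "a # xs @ [b]" and ?p2 = "a # rev ys @ [b]" and ?p3 = "[a, u, b]"
  have e2: "path_edges ?p2 = path_edges (b # ys @ [a])"
    using path_edges_rev[of "b # ys @ [a]"] by simp
  have C: "C = path_edges ?p1 \<union> path_edges ?p2"
    using cyc(2) path_edges_append[of "a # xs" b "ys @ [a]"] unfolding e2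
    by (simp add: cycle_edges_eq_path_edges)
  have p3: "path_edges ?p3 = {{a, u}, {u, b}}" by simp
  have sub: "path_edges ?p1 \<subseteq> ?E" "path_edges ?p2 \<subseteq> ?E" "path_edges ?p3 \<subseteq> ?E" "path_edges q \<subseteq> ?E"
    using C u q(1) by (auto simp: insert_commute graph_path_def)
  obtain c1 where c1: "arc c1" "pathstart c1 = pos a" "pathfinish c1 = pos b"
    "path_image c1 = img (path_edges ?p1)"
    using path_arc[OF emb _ sub(1)] cyc(1) unfolding img_def by auto
  obtain c2 where c2: "arc c2" "pathstart c2 = pos a" "pathfinish c2 = pos b"
    "path_image c2 = img (path_edges ?p2)"
    using path_arc[OF emb _ sub(2)] cyc(1) unfolding img_def by auto
  obtain c where c: "arc c" "pathstart c = pos a" "pathfinish c = pos b"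
    "path_image c = img (path_edges ?p3)"
    using path_arc[OF emb _ sub(3)] cyc(1) au unfolding img_def by auto
  have q2: "2 \<le> length q"
  proof (rule ccontr)
    assume "\<not> 2 \<le> length q"
    then have "hd q = last q"
      using q(1) unfolding graph_path_def by (cases q; cases "tl q") auto
    then show False using q(2,3) cyc(1) by auto
  qed
  have q_dist: "distinct q" using q(1) unfolding graph_path_def by blast
  obtain g where g: "arc g" "path_image g = img (path_edges q)"
    using path_arc[OF emb q_dist sub(4) q2] unfolding img_def .
  have in1: "e \<inter> set xs \<noteq> {}" if "e \<in> path_edges ?p1" for e
    using inner_edge_meets_path[OF ne(1) that] .
  have in2: "e \<inter> set ys \<noteq> {}" if "e \<in> path_edges ?p2" for e
    using inner_edge_meets_path[of "rev ys" e a b] ne(2) that by simp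
  have un1: "\<Union> (path_edges ?p1) = insert a (insert b (set xs))"
    by (subst Union_path_edges) auto
  have un2: "\<Union> (path_edges ?p2) = insert a (insert b (set ys))"
    by (subst Union_path_edges) auto
  have un3: "\<Union> (path_edges ?p3) = {a, b, u}" by auto
  have unq: "\<Union> (path_edges q) = set q" by (rule Union_path_edges[OF q2])
  have vs: "insert a (insert b (set xs)) \<subseteq> V" "insert a (insert b (set ys)) \<subseteq> V" "{a, b, u} \<subseteq> V" "set q \<subseteq> V"
    using cyc(3) L_sub uV q(1) by (auto simp: graph_path_def)
  have u_notin: "u \<notin> set xs" "u \<notin> set ys" using u(3) cyc(3) by auto
  have int: "img A \<inter> img B = pos ` (\<Union> A \<inter> \<Union> B)"
    if "A \<subseteq> ?E" "B \<subseteq> ?E" "A \<inter> B = {}" "\<Union> A \<subseteq> V" "\<Union> B \<subseteq> V" for A B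
    using edge_images_Int[OF emb that] unfolding img_def .
  have "path_edges ?p1 \<inter> path_edges ?p2 = {}"
    using in1 path_edge_subset[of _ ?p2] cyc(1) by fastforce
  then have c1c2: "path_image c1 \<inter> path_image c2 = {pos a, pos b}"
    using int[OF sub(1,2)] un1 un2 vs cyc(1) unfolding c1(4) c2(4) by (auto 0 3)
  have "path_edges ?p1 \<inter> path_edges ?p3 = {}"
    using path_edge_subset[of _ ?p1] u_notin au unfolding p3 by fastforce
  then have c1c: "path_image c1 \<inter> path_image c = {pos a, pos b}"
    using int[OF sub(1,3)] un1 un3 vs cyc(1) u_notin unfolding c1(4) c(4) by auto
  have "path_edges ?p2 \<inter> path_edges ?p3 = {}"
    using path_edge_subset[of _ ?p2] u_notin au unfolding p3 by fastforce
  then have c2c: "path_image c2 \<inter> path_image c = {pos a, pos b}"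
    using int[OF sub(2,3)] un2 un3 vs cyc(1) u_notin unfolding c2(4) c(4) by auto
  have "path_edges q \<inter> path_edges ?p3 = {}"
    using path_edge_subset[of _ q] q unfolding p3 by fastforce
  then have gc: "path_image g \<inter> path_image c = {}"
    using int[OF sub(4,3)] unq un3 vs q unfolding g(2) c(4) by auto
  have imgC: "img C = path_image c1 \<union> path_image c2"
    unfolding C c1(4) c2(4) img_def by blast
  have "finite ?E"
  proof -
    have "finite V" using tree unfolding tree_def simple_graph_def by blast
    then have "finite T" using T_sub finite_subset[of T "Pow V"] by auto
    then show ?thesis unfolding C by simp
  qed
  then have "compact (\<Union>e \<in> ?E. path_image (\<gamma> e))"
    using plane_embeddingD(2)[OF emb] by (intro compact_UN) (auto intro: compact_arc_image)
  moreover have "finite V" using tree unfolding tree_def simple_graph_def by blast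
  ultimately have "compact (drawing V ?E pos \<gamma>)"
    unfolding drawing_def using finite_imp_compact[of "pos ` V"] by (intro compact_Un) auto
  moreover have "img C \<subseteq> drawing V ?E pos \<gamma>" unfolding drawing_def img_def by blast
  moreover have "compact (img C)"
    unfolding imgC using c1(1) c2(1) by (intro compact_Un) (auto intro: compact_arc_image)
  ultimately have inner: "drawing V ?E pos \<gamma> \<subseteq> img C \<union> inside (img C)"
    using drawing_within_boundary front by blast
  have "path_image c \<subseteq> drawing V ?E pos \<gamma>"
    unfolding c(4) drawing_def using sub(3) unfolding img_def by blast
  moreover have "pos u \<in> path_image c"
    using vertex_on_edge[OF emb, of "{a, u}" u] u(1) unfolding c(4) img_def by simp
  moreover have "pos u \<notin> path_image c1 \<union> path_image c2"
  proof
    assume "pos u \<in> path_image c1 \<union> path_image c2"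
    then have "pos u \<in> {pos a, pos b}" using c1c c2c \<open>pos u \<in> path_image c\<close> by blast
    then show False
      using plane_embeddingD(1)[OF emb] au vs by (auto dest: inj_onD)
  qed
  ultimately have chord: "path_image c \<inter> inside (path_image c1 \<union> path_image c2) \<noteq> {}"
    using inner unfolding imgC by blast
  have "path_image g \<subseteq> drawing V ?E pos \<gamma>"
    unfolding g(2) drawing_def using sub(4) unfolding img_def by blast
  then have B: "path_image g \<subseteq> path_image c1 \<union> path_image c2 \<union> inside (path_image c1 \<union> path_image c2)"
    using inner unfolding imgC by (rule order.trans)
  have on_img: "pos v \<in> img (path_edges p)" if p: "path_edges p \<subseteq> ?E" "v \<in> \<Union> (path_edges p)" for p v
    using p vertex_on_edge[OF emb] unfolding img_def by blast
  have "pos (hd q) \<in> path_image g \<inter> path_image c1"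
    using on_img[OF sub(1)] on_img[OF sub(4)] q(2) q2 unfolding g(2) c1(4) un1 unq
    by (cases q) auto
  moreover have "pos (last q) \<in> path_image g \<inter> path_image c2"
    using on_img[OF sub(2)] on_img[OF sub(4)] q(3) q2 unfolding g(2) c2(4) un2 unq
    by (cases q) auto
  ultimately show False
    using connected_set_misses_chord[OF c1(1-3) c2(1-3) c(1-3) c1c2 c1c c2c chord _ gc B] g(1)
    by (auto simp: connected_arc_image)
qed


section \<open>Coloring the cycle through the leaves\<close>

text \<open>Greedy list coloring: the elements of \<open>J\<close> are recolored one after the other, while \<open>s\<close> is kept
  outside \<open>J\<close>. The set \<open>X x\<close> collects the colors forbidden from the start, and \<open>N x\<close> the elements whose
  color must be avoided, inside or outside \<open>J\<close>.\<close>

lemma greedy_extension: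
  fixes s :: "'b \<Rightarrow> nat" and X :: "'b \<Rightarrow> nat set" and N :: "'b \<Rightarrow> 'b set"
  assumes "finite J"
    and fin: "\<And>x. x \<in> J \<Longrightarrow> finite (X x)" "\<And>x. x \<in> J \<Longrightarrow> finite (N x)"
    and room: "\<And>x. x \<in> J \<Longrightarrow> card (X x) + card (N x) < K"
    and sym: "\<And>x y. x \<in> J \<Longrightarrow> y \<in> J \<Longrightarrow> y \<in> N x \<Longrightarrow> x \<in> N y"
    and irrefl: "\<And>x. x \<in> J \<Longrightarrow> x \<notin> N x"
  shows "\<exists>s'. (\<forall>x. x \<notin> J \<longrightarrow> s' x = s x) \<and>
    (\<forall>x\<in>J. s' x < K \<and> s' x \<notin> X x \<and> (\<forall>y\<in>N x. s' y \<noteq> s' x))"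
  using assms
proof (induction J rule: finite_induct)
  case empty
  then show ?case by auto
next
  case (insert x J)
  have "\<exists>s'. (\<forall>x. x \<notin> J \<longrightarrow> s' x = s x) \<and>
      (\<forall>x\<in>J. s' x < K \<and> s' x \<notin> X x \<and> (\<forall>y\<in>N x. s' y \<noteq> s' x))"
    by (rule insert.IH) (use insert.prems in auto)
  then obtain s' where s': "\<And>x. x \<notin> J \<Longrightarrow> s' x = s x"
    "\<And>x. x \<in> J \<Longrightarrow> s' x < K" "\<And>x. x \<in> J \<Longrightarrow> s' x \<notin> X x"
    "\<And>x y. x \<in> J \<Longrightarrow> y \<in> N x \<Longrightarrow> s' y \<noteq> s' x"
    by metis
  let ?bad = "X x \<union> s' ` N x"
  have "finite ?bad" using insert.prems by auto
  have "card ?bad \<le> card (X x) + card (N x)"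
    using insert.prems(2)[of x] by (intro order.trans[OF card_Un_le] add_mono card_image_le) auto
  also have "\<dots> < card {..<K}" using insert.prems(3)[of x] by simp
  finally have "\<not> {..<K} \<subseteq> ?bad"
    using card_mono[OF \<open>finite ?bad\<close>, of "{..<K}"] by linarith
  then obtain k where k: "k < K" "k \<notin> X x" "k \<notin> s' ` N x" by auto
  have "(s'(x := k)) z \<noteq> (s'(x := k)) y" if "y \<in> insert x J" "z \<in> N y" for y z
  proof (cases "y = x")
    case True
    then have "z \<noteq> x" using insert.prems(5)[of x] that by auto
    then show ?thesis using True k(3) that by auto
  next
    case False
    then have y: "y \<in> J" using that by simp
    show ?thesis
    proof (cases "z = x")
      case True
      then have "y \<in> N x" using insert.prems(4)[of y x] that by auto
      then show ?thesis using True False k(3) by auto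
    next
      case False': False
      then show ?thesis using False s'(4)[OF y that(2)] by simp
    qed
  qed
  then show ?case
    using s' k insert.hyps by (intro exI[of _ "s'(x := k)"]) auto
qed

lemma mod_3_differ:
  fixes i j :: nat
  assumes "i \<noteq> j" "i \<le> j + 2" "j \<le> i + 2"
  shows "i mod 3 \<noteq> j mod 3"
  using assms
proof (induction i j rule: linorder_wlog)
  case (le i j)
  show ?case
  proof
    assume "i mod 3 = j mod 3"
    then have "3 dvd j - i" using le(1) mod_eq_dvd_iff_nat[of i j 3] by simp
    then show False using le dvd_imp_le[of 3 "j - i"] by simp
  qed
next
  case (sym i j)
  then show ?case by metis
qed

text \<open>What the coloring of the cycle needs to know about the plane graph: \<open>p\<close> lists the leaves in the order
  of the adjoint cycle, \<open>par v\<close> is the neighbour of the leaf \<open>v\<close> in the tree, and the leaves with the same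
  neighbour (a family) form an interval of \<open>p\<close>. The list is cut between two families, so that no
  family wraps around and edges inside families join entries of \<open>p\<close> with successive indices.\<close>

locale leaf_cycle =
  fixes T :: "'a set set" and p :: "'a list" and par :: "'a \<Rightarrow> 'a"
    and c :: "'a set \<Rightarrow> nat" and K :: nat
  assumes dist: "distinct p" and len: "3 \<le> length p"
    and finT: "finite T" and cardT: "\<And>e. e \<in> T \<Longrightarrow> card e = 2"
    and par_edge: "\<And>v. v \<in> set p \<Longrightarrow> {v, par v} \<in> T"
    and par_inner: "\<And>v. v \<in> set p \<Longrightarrow> par v \<notin> set p"
    and leaf_edge: "\<And>v e. v \<in> set p \<Longrightarrow> e \<in> T \<Longrightarrow> v \<in> e \<Longrightarrow> e = {v, par v}"
    and contiguous: "\<And>i j k. i < j \<Longrightarrow> j < k \<Longrightarrow> k < length p \<Longrightarrow> par (p ! i) = par (p ! k) \<Longrightarrow>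
      par (p ! j) = par (p ! i)"
    and ends: "par (p ! 0) \<noteq> par (p ! (length p - 1))"
    and sibling: "\<And>v. v \<in> set p \<Longrightarrow> \<exists>w \<in> set p. w \<noteq> v \<and> par w = par v"
    and deg: "\<And>v. v \<in> set p \<Longrightarrow> degree T (par v) \<le> Suc (card {w \<in> set p. par w = par v})"
    and properT: "proper_edge_coloring T K c" and starT: "no_bicolored_walk T c"
    and K9: "9 \<le> K" and K_deg: "\<And>v. v \<in> set p \<Longrightarrow> degree T (par v) + 3 \<le> K"
begin

abbreviation "C \<equiv> cycle_edges p"
abbreviation "m \<equiv> length p"

text \<open>An edge of the cycle inside a family. The other edges of the cycle are referred to as boundary
  edges; they are the ones that receive the additional color \<open>K\<close>.\<close>

definition internal :: "'a set \<Rightarrow> bool" where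
  "internal e \<longleftrightarrow> e \<in> C \<and> (\<exists>u. \<forall>v\<in>e. par v = u)"

text \<open>The only edge inside a family of two leaves; both its neighbours on the cycle are boundary edges.\<close>

definition isolated :: "'a set \<Rightarrow> bool" where
  "isolated e \<longleftrightarrow> internal e \<and> (\<forall>f. internal f \<longrightarrow> f \<inter> e \<noteq> {} \<longrightarrow> f = e)"

lemma C_edge:
  assumes "e \<in> C"
  obtains i where "i < m" "e = {p ! i, p ! (Suc i mod m)}"
  using assms unfolding cycle_edges_def by blast

lemma nth_inj: "i < m \<Longrightarrow> j < m \<Longrightarrow> p ! i = p ! j \<longleftrightarrow> i = j"
  using dist by (simp add: nth_eq_iff_index_eq)

lemma C_edge_pair:
  assumes "e \<in> C"
  shows "e \<subseteq> set p" "card e = 2"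
proof -
  obtain i where i: "i < m" "e = {p ! i, p ! (Suc i mod m)}" using C_edge[OF assms] .
  have j: "Suc i mod m < m" using len by (intro mod_less_divisor) linarith
  then show "e \<subseteq> set p" using i by simp
  have "Suc i mod m \<noteq> i"
    using i(1) len by (cases "Suc i = m") auto
  then show "card e = 2" using i j by (simp add: nth_inj)
qed

lemma finite_C: "finite C"
proof -
  have "C \<subseteq> Pow (set p)" using C_edge_pair(1) by blast
  then show ?thesis by (rule finite_subset) simp
qed

lemma internal_par: "internal e \<Longrightarrow> v \<in> e \<Longrightarrow> w \<in> e \<Longrightarrow> par v = par w"
  unfolding internal_def by metis

lemma internalD: "internal e \<Longrightarrow> e \<in> C" "internal e \<Longrightarrow> e \<subseteq> set p"
  unfolding internal_def using C_edge_pair(1) by blast+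

lemma internalI:
  assumes "Suc i < m" "par (p ! i) = par (p ! Suc i)"
  shows "internal {p ! i, p ! Suc i}"
proof -
  have "{p ! i, p ! Suc i} \<in> C"
    unfolding cycle_edges_def using assms(1) by (intro CollectI exI[of _ i]) simp
  then show ?thesis unfolding internal_def using assms(2) by auto
qed

lemma internal_index:
  assumes "internal e"
  obtains i where "Suc i < m" "e = {p ! i, p ! Suc i}" "par (p ! i) = par (p ! Suc i)"
proof -
  obtain i where i: "i < m" "e = {p ! i, p ! (Suc i mod m)}"
    using C_edge internalD(1)[OF assms] by blast
  have par: "par (p ! i) = par (p ! (Suc i mod m))"
    using internal_par[OF assms] i(2) by blast
  have "Suc i \<noteq> m"
  proof
    assume "Suc i = m"
    then have "i = m - 1" "Suc i mod m = 0" by auto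
    then show False using par ends by simp
  qed
  then have "Suc i < m" using i(1) by simp
  then show ?thesis using that[of i] i(2) par by simp
qed

lemma C_degree:
  assumes "v \<in> set p"
  shows "card {e \<in> C. v \<in> e} \<le> 2"
proof -
  obtain i where i: "i < m" "v = p ! i" using assms by (auto simp: in_set_conv_nth)
  have "e \<in> {{p ! i, p ! (Suc i mod m)}, {p ! ((i + m - 1) mod m), p ! i}}"
    if e: "e \<in> C" "v \<in> e" for e
  proof -
    obtain j where j: "j < m" "e = {p ! j, p ! (Suc j mod m)}" using C_edge[OF e(1)] .
    have "Suc j mod m < m" using len by (intro mod_less_divisor) linarith
    then consider "i = j" | "i = Suc j mod m" using e(2) i j by (auto simp: nth_inj)
    then show ?thesis
    proof cases
      case 2
      have "(i + m - 1) mod m = j"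
      proof (cases "Suc j = m")
        case True
        then show ?thesis using 2 by auto
      next
        case False
        then have "i = Suc j" using 2 j by simp
        then show ?thesis using j by simp
      qed
      then show ?thesis using 2 j by simp
    qed (use j in simp)
  qed
  then have "{e \<in> C. v \<in> e} \<subseteq> {{p ! i, p ! (Suc i mod m)}, {p ! ((i + m - 1) mod m), p ! i}}"
    by blast
  then have "card {e \<in> C. v \<in> e} \<le> card {{p ! i, p ! (Suc i mod m)}, {p ! ((i + m - 1) mod m), p ! i}}"
    by (intro card_mono) auto
  also have "\<dots> \<le> 2" by (simp add: card_insert_if)
  finally show ?thesis .
qed

lemma internal_before:
  assumes "k < i" "i < m" "par (p ! k) = par (p ! i)"
  shows "internal {p ! (i - 1), p ! i}"
proof -
  have "par (p ! (i - 1)) = par (p ! i)"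
    using contiguous[of k "i - 1" i] assms by (cases "k = i - 1") auto
  then show ?thesis using internalI[of "i - 1"] assms by simp
qed

lemma internal_after:
  assumes "i < k" "k < m" "par (p ! k) = par (p ! i)"
  shows "internal {p ! i, p ! Suc i}"
proof -
  have "par (p ! Suc i) = par (p ! i)"
    using contiguous[of i "Suc i" k] assms by (cases "k = Suc i") auto
  then show ?thesis using internalI[of i] assms by simp
qed

lemma internal_at:
  assumes "v \<in> set p"
  obtains e where "internal e" "v \<in> e"
proof -
  obtain i where i: "i < m" "v = p ! i" using assms by (auto simp: in_set_conv_nth)
  obtain k where k: "k < m" "p ! k \<noteq> p ! i" "par (p ! k) = par (p ! i)"
    using sibling[OF assms] i by (auto simp: in_set_conv_nth)
  then consider "k < i" | "i < k" by (metis nat_neq_iff)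
  then show ?thesis
    using internal_before[of k i] internal_after[of i k] i k that by cases auto
qed

text \<open>Every leaf lies on an internal edge, because families have at least two members; this leaves room
  for only one boundary edge.\<close>

lemma boundary_unique:
  assumes "f \<in> C" "g \<in> C" "\<not> internal f" "\<not> internal g" "v \<in> f" "v \<in> g"
  shows "f = g"
proof (rule ccontr)
  assume "f \<noteq> g"
  have v: "v \<in> set p" using C_edge_pair(1) assms by blast
  obtain e where e: "internal e" "v \<in> e" using internal_at[OF v] .
  have "e \<noteq> f" "e \<noteq> g" using e assms by auto
  then have "card {e, f, g} = 3" using \<open>f \<noteq> g\<close> by simp
  moreover have "{e, f, g} \<subseteq> {e \<in> C. v \<in> e}" using e assms internalD by blast
  then have "card {e, f, g} \<le> card {e \<in> C. v \<in> e}" by (intro card_mono) (simp_all add: finite_C)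
  ultimately show False using C_degree[OF v] by simp
qed

lemma other_edge:
  assumes "v \<in> set p" "e \<in> C" "v \<in> e"
  obtains a where "a \<in> set p" "\<And>f. f \<in> C \<Longrightarrow> v \<in> f \<Longrightarrow> f \<noteq> e \<Longrightarrow> f = {v, a}"
proof (cases "\<exists>f\<in>C. v \<in> f \<and> f \<noteq> e")
  case True
  then obtain g where g: "g \<in> C" "v \<in> g" "g \<noteq> e" by blast
  obtain x y where "g = {x, y}" using C_edge_pair(2)[OF g(1)] by (auto simp: card_2_iff)
  then obtain a where a: "g = {v, a}" using g(2) by auto
  have "f = g" if f: "f \<in> C" "v \<in> f" "f \<noteq> e" for f
  proof (rule ccontr)
    assume "f \<noteq> g"
    then have "card {e, f, g} = 3" using f g by simp
    moreover have "card {e, f, g} \<le> card {e \<in> C. v \<in> e}"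
      using f g assms by (intro card_mono) (auto simp: finite_C)
    ultimately show False using C_degree[OF assms(1)] by simp
  qed
  moreover have "a \<in> set p" using C_edge_pair(1)[OF g(1)] a by blast
  ultimately show ?thesis using that[of a] a by blast
next
  case False
  then show ?thesis using that[of v] assms(1) by blast
qed

lemma isolatedD: "isolated e \<Longrightarrow> internal e" "isolated e \<Longrightarrow> internal f \<Longrightarrow> f \<inter> e \<noteq> {} \<Longrightarrow> f = e"
  unfolding isolated_def by blast+

text \<open>A third member of the family would be adjacent on the cycle to one of the two, by contiguity.\<close>

lemma isolated_degree:
  assumes "isolated e" "v \<in> e"
  shows "degree T (par v) \<le> 3"
proof -
  note e = isolatedD[OF assms(1)]
  obtain i where i: "Suc i < m" "e = {p ! i, p ! Suc i}" "par (p ! i) = par (p ! Suc i)"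
    using internal_index[OF e(1)] .
  have v: "v \<in> set p" "par v = par (p ! i)"
    using internalD(2)[OF e(1)] assms(2) i by auto
  have "w \<in> e" if w: "w \<in> set p" "par w = par v" for w
  proof -
    obtain k where k: "k < m" "w = p ! k" using w by (auto simp: in_set_conv_nth)
    have pk: "par (p ! k) = par (p ! i)" using w k v by simp
    consider "k < i" | "k = i" | "k = Suc i" | "Suc i < k" by linarith
    then show ?thesis
    proof cases
      case 1
      have "{p ! (i - 1), p ! i} = e"
        using e(2)[OF internal_before[OF 1 _ pk]] i by auto
      then have "p ! (i - 1) \<in> {p ! i, p ! Suc i}" using i(2) by blast
      then show ?thesis using 1 i(1) by (auto simp: nth_inj)
    next
      case 4
      have "{p ! Suc i, p ! Suc (Suc i)} = e"
        using e(2)[OF internal_after[OF 4 k(1)]] pk i by auto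
      then have "p ! Suc (Suc i) \<in> {p ! i, p ! Suc i}" using i(2) by blast
      then show ?thesis using 4 k(1) by (auto simp: nth_inj)
    qed (use i k in auto)
  qed
  then have "{w \<in> set p. par w = par v} \<subseteq> e" by blast
  then have "card {w \<in> set p. par w = par v} \<le> 2"
    using i(2) card_mono[of e] C_edge_pair(2)[OF internalD(1)[OF e(1)]] by force
  then show ?thesis using deg[OF v(1)] by simp
qed

text \<open>Three colors that are absent at \<open>u\<close> are repeated with period three along the family of \<open>u\<close>.\<close>

lemma periodic_coloring:
  obtains s :: "'a set \<Rightarrow> nat" where
    "\<And>e v. internal e \<Longrightarrow> v \<in> e \<Longrightarrow> s e < K \<and> s e \<notin> c ` {t \<in> T. par v \<in> t}"
    "\<And>i j. internal {p ! i, p ! Suc i} \<Longrightarrow> internal {p ! j, p ! Suc j} \<Longrightarrow> Suc i < m \<Longrightarrow> Suc j < m \<Longrightarrow>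
      par (p ! i) = par (p ! j) \<Longrightarrow> i mod 3 \<noteq> j mod 3 \<Longrightarrow> s {p ! i, p ! Suc i} \<noteq> s {p ! j, p ! Suc j}"
proof -
  have "\<exists>g :: nat \<Rightarrow> nat. inj_on g {..<3} \<and> g ` {..<3} \<subseteq> {..<K} - c ` {t \<in> T. u \<in> t}"
    if u: "u \<in> par ` set p" for u
  proof -
    have "c ` {t \<in> T. u \<in> t} \<subseteq> {..<K}" using properT unfolding proper_edge_coloring_def by blast
    then have "card ({..<K} - c ` {t \<in> T. u \<in> t}) = K - card (c ` {t \<in> T. u \<in> t})"
      by (subst card_Diff_subset) (auto simp: finT)
    moreover have "card (c ` {t \<in> T. u \<in> t}) \<le> degree T u"
      unfolding degree_def by (rule card_image_le) (simp add: finT)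
    ultimately have "card {..<3::nat} \<le> card ({..<K} - c ` {t \<in> T. u \<in> t})"
      using K_deg u by fastforce
    then show ?thesis 
      using card_le_inj[of "{..<3::nat}" "{..<K} - c ` {t \<in> T. u \<in> t}"] by auto
  qed
  then obtain g :: "'a \<Rightarrow> nat \<Rightarrow> nat" where g: "\<And>u. u \<in> par ` set p \<Longrightarrow> inj_on (g u) {..<3}"
    "\<And>u. u \<in> par ` set p \<Longrightarrow> g u ` {..<3} \<subseteq> {..<K} - c ` {t \<in> T. u \<in> t}"
    by metis
  define idx where "idx e = (SOME i. Suc i < m \<and> e = {p ! i, p ! Suc i})" for e
  define s where "s e = g (par (p ! idx e)) (idx e mod 3)" for e
  have idx: "idx {p ! i, p ! Suc i} = i" if "Suc i < m" for i
  proof -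
    have "Suc (idx {p ! i, p ! Suc i}) < m \<and>
        {p ! i, p ! Suc i} = {p ! idx {p ! i, p ! Suc i}, p ! Suc (idx {p ! i, p ! Suc i})}"
      unfolding idx_def by (rule someI[of _ i]) (simp add: that)
    then show ?thesis using that by (auto simp: doubleton_eq_iff nth_inj)
  qed
  show ?thesis
  proof (rule that[of s])
    fix e v assume e: "internal e" "v \<in> e"
    obtain i where i: "Suc i < m" "e = {p ! i, p ! Suc i}" using internal_index[OF e(1)] .
    have "par v = par (p ! i)" using internal_par[OF e] i by simp
    moreover have "s e = g (par (p ! i)) (i mod 3)" using i by (simp add: s_def idx)
    then have "s e \<in> g (par (p ! i)) ` {..<3}" by simp
    moreover have "par (p ! i) \<in> par ` set p" using i(1) by simp
    ultimately have "s e \<in> {..<K} - c ` {t \<in> T. par v \<in> t}"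
      using g(2)[of "par (p ! i)"] by (metis subsetD)
    then show "s e < K \<and> s e \<notin> c ` {t \<in> T. par v \<in> t}" by blast
  next
    fix i j assume ij: "Suc i < m" "Suc j < m" "par (p ! i) = par (p ! j)" "i mod 3 \<noteq> j mod 3"
    have "inj_on (g (par (p ! i))) {..<3}" using ij g(1) by simp
    then show "s {p ! i, p ! Suc i} \<noteq> s {p ! j, p ! Suc j}"
      unfolding s_def using ij by (auto simp: idx dest!: inj_onD)
  qed
qed

text \<open>The colors that an isolated edge \<open>e\<close> must avoid: at most three at the common neighbour of its ends, the colors
  of the tree edges at the two leaves next to \<open>e\<close> on the cycle, and the colors of the two cycle edges
  at distance one from \<open>e\<close>. These are at most seven.\<close>

lemma isolated_constraints:
  assumes e: "isolated e"
  defines "X \<equiv> c ` {t \<in> T. (\<exists>v\<in>e. par v \<in> t) \<or> (\<exists>g\<in>C. g \<inter> e \<noteq> {} \<and> t \<inter> g \<noteq> {})}"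
    and "N \<equiv> {f \<in> C. f \<inter> e = {} \<and> (\<exists>g\<in>C. g \<inter> e \<noteq> {} \<and> f \<inter> g \<noteq> {})}"
  shows "card X + card N < K"
proof -
  note eC = internalD[OF isolatedD(1)[OF e]]
  have "card e = 2" by (rule C_edge_pair(2)[OF eC(1)])
  then obtain x y where xy: "e = {x, y}" by (auto simp: card_2_iff)
  have L: "x \<in> set p" "y \<in> set p" using xy eC by auto
  have par: "par y = par x" using internal_par isolatedD(1)[OF e] xy by blast
  obtain a where a: "a \<in> set p" "\<And>f. f \<in> C \<Longrightarrow> x \<in> f \<Longrightarrow> f \<noteq> e \<Longrightarrow> f = {x, a}"
    using other_edge[OF L(1) eC(1)] xy by blast
  obtain b where b: "b \<in> set p" "\<And>f. f \<in> C \<Longrightarrow> y \<in> f \<Longrightarrow> f \<noteq> e \<Longrightarrow> f = {y, b}"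
    using other_edge[OF L(2) eC(1)] xy by blast
  \<comment> \<open>The leaves a and b are the neighbours of e on the cycle.\<close>
  have near: "g = e \<or> g = {x, a} \<or> g = {y, b}" if "g \<in> C" "g \<inter> e \<noteq> {}" for g
    using a(2)[of g] b(2)[of g] that xy by auto
  have "X \<subseteq> c ` {t \<in> T. par x \<in> t} \<union> {c {a, par a}, c {b, par b}}"
  proof
    fix k assume "k \<in> X"
    then obtain t where t: "k = c t" "t \<in> T" "(\<exists>v\<in>e. par v \<in> t) \<or> (\<exists>g\<in>C. g \<inter> e \<noteq> {} \<and> t \<inter> g \<noteq> {})"
      unfolding X_def by blast
    have "x \<in> t \<or> y \<in> t \<or> a \<in> t \<or> b \<in> t" if "g \<in> C" "g \<inter> e \<noteq> {}" "t \<inter> g \<noteq> {}" for g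
      using near[OF that(1,2)] that(3) xy by auto
    moreover have "par x \<in> t" if "v \<in> e" "par v \<in> t" for v
      using that xy par by auto
    ultimately have "par x \<in> t \<or> x \<in> t \<or> y \<in> t \<or> a \<in> t \<or> b \<in> t"
      using t(3) by blast
    then have "par x \<in> t \<or> t = {a, par a} \<or> t = {b, par b}"
      using leaf_edge[OF L(1) t(2)] leaf_edge[OF L(2) t(2)] leaf_edge[OF a(1) t(2)]
        leaf_edge[OF b(1) t(2)] par by auto
    then show "k \<in> c ` {t \<in> T. par x \<in> t} \<union> {c {a, par a}, c {b, par b}}" using t by blast
  qed
  then have "card X \<le> card (c ` {t \<in> T. par x \<in> t} \<union> {c {a, par a}, c {b, par b}})"
    by (intro card_mono) (auto simp: finT)
  also have "\<dots> \<le> card (c ` {t \<in> T. par x \<in> t}) + card {c {a, par a}, c {b, par b}}"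
    by (rule card_Un_le)
  also have "\<dots> \<le> 3 + 2"
  proof (rule add_mono)
    have "card (c ` {t \<in> T. par x \<in> t}) \<le> degree T (par x)"
      unfolding degree_def by (rule card_image_le) (simp add: finT)
    then show "card (c ` {t \<in> T. par x \<in> t}) \<le> 3" using isolated_degree[OF e, of x] xy by simp
  qed (simp add: card_insert_if)
  finally have "card X \<le> 5" by simp
  have next_edge: "\<exists>f1. \<forall>f\<in>C. f \<inter> e = {} \<longrightarrow> w \<in> f \<longrightarrow> {z, w} \<in> C \<longrightarrow> f = f1"
    if w: "w \<in> set p" "z \<in> e" for w z
  proof (cases "{z, w} \<in> C")
    case True
    obtain d where "\<And>f. f \<in> C \<Longrightarrow> w \<in> f \<Longrightarrow> f \<noteq> {z, w} \<Longrightarrow> f = {w, d}"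
      using other_edge[OF w(1) True] by blast
    then show ?thesis using w(2) by (intro exI[of _ "{w, d}"]) blast
  qed blast
  obtain f1 f2 where f12: "\<forall>f\<in>C. f \<inter> e = {} \<longrightarrow> a \<in> f \<longrightarrow> {x, a} \<in> C \<longrightarrow> f = f1"
    "\<forall>f\<in>C. f \<inter> e = {} \<longrightarrow> b \<in> f \<longrightarrow> {y, b} \<in> C \<longrightarrow> f = f2"
  proof -
    have "x \<in> e" "y \<in> e" using xy by simp_all
    then show ?thesis using that next_edge[OF a(1)] next_edge[OF b(1)] by metis
  qed
  have "N \<subseteq> {f1, f2}"
  proof
    fix f assume "f \<in> N"
    then obtain g where f: "f \<in> C" "f \<inter> e = {}" "g \<in> C" "g \<inter> e \<noteq> {}" "f \<inter> g \<noteq> {}"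
      unfolding N_def by blast
    then have "g = {x, a} \<and> a \<in> f \<or> g = {y, b} \<and> b \<in> f" using near[of g] xy by blast
    then show "f \<in> {f1, f2}" using f12 f by blast
  qed
  then have "card N \<le> card {f1, f2}" by (intro card_mono) auto
  also have "\<dots> \<le> 2" by (simp add: card_insert_if)
  finally show ?thesis using \<open>card X \<le> 5\<close> K9 by simp
qed

text \<open>Start from the periodic coloring and recolor the isolated edges greedily. The conditions on adjacent
  and on consecutive internal edges survive, because an internal edge with an internal neighbour is
  not isolated.\<close>

lemma internal_coloring:
  obtains s :: "'a set \<Rightarrow> nat" where
    "\<And>e v. internal e \<Longrightarrow> v \<in> e \<Longrightarrow> s e < K"
    "\<And>e v t. internal e \<Longrightarrow> v \<in> e \<Longrightarrow> t \<in> T \<Longrightarrow> par v \<in> t \<Longrightarrow> c t \<noteq> s e"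
    "\<And>e f. internal e \<Longrightarrow> internal f \<Longrightarrow> e \<noteq> f \<Longrightarrow> e \<inter> f \<noteq> {} \<Longrightarrow> s e \<noteq> s f"
    "\<And>w x y z. internal {w, x} \<Longrightarrow> internal {x, y} \<Longrightarrow> internal {y, z} \<Longrightarrow> w \<noteq> y \<Longrightarrow> x \<noteq> z \<Longrightarrow>
      s {w, x} \<noteq> s {y, z}"
    "\<And>e g t. isolated e \<Longrightarrow> g \<in> C \<Longrightarrow> g \<inter> e \<noteq> {} \<Longrightarrow> t \<in> T \<Longrightarrow> t \<inter> g \<noteq> {} \<Longrightarrow> c t \<noteq> s e"
    "\<And>e g f. isolated e \<Longrightarrow> g \<in> C \<Longrightarrow> g \<inter> e \<noteq> {} \<Longrightarrow> f \<in> C \<Longrightarrow> f \<inter> e = {} \<Longrightarrow> f \<inter> g \<noteq> {} \<Longrightarrow>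
      s f \<noteq> s e"
proof (rule periodic_coloring)
  fix s0 :: "'a set \<Rightarrow> nat"
  assume s0: "\<And>e v. internal e \<Longrightarrow> v \<in> e \<Longrightarrow> s0 e < K \<and> s0 e \<notin> c ` {t \<in> T. par v \<in> t}"
    "\<And>i j. internal {p ! i, p ! Suc i} \<Longrightarrow> internal {p ! j, p ! Suc j} \<Longrightarrow> Suc i < m \<Longrightarrow> Suc j < m \<Longrightarrow>
      par (p ! i) = par (p ! j) \<Longrightarrow> i mod 3 \<noteq> j mod 3 \<Longrightarrow> s0 {p ! i, p ! Suc i} \<noteq> s0 {p ! j, p ! Suc j}"
  let ?J = "{e. isolated e}"
  let ?X = "\<lambda>e. c ` {t \<in> T. (\<exists>v\<in>e. par v \<in> t) \<or> (\<exists>g\<in>C. g \<inter> e \<noteq> {} \<and> t \<inter> g \<noteq> {})}"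
  let ?N = "\<lambda>e. {f \<in> C. f \<inter> e = {} \<and> (\<exists>g\<in>C. g \<inter> e \<noteq> {} \<and> f \<inter> g \<noteq> {})}"
  have J: "e \<in> C" "e \<noteq> {}" if "isolated e" for e
    using that isolatedD(1) internalD(1) C_edge_pair(2) by force+
  have "\<exists>s. (\<forall>e. e \<notin> ?J \<longrightarrow> s e = s0 e) \<and>
      (\<forall>e\<in>?J. s e < K \<and> s e \<notin> ?X e \<and> (\<forall>f\<in>?N e. s f \<noteq> s e))"
  proof (rule greedy_extension)
    show "finite ?J" using J finite_subset[OF _ finite_C] by blast
    show "card (?X e) + card (?N e) < K" if "e \<in> ?J" for e
      using isolated_constraints that by blast
    show "e \<in> ?N f" if "e \<in> ?J" "f \<in> ?J" "f \<in> ?N e" for e f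
      using that J(1) by blast
    show "e \<notin> ?N e" if "e \<in> ?J" for e using J(2) that by blast
  qed (simp_all add: finT finite_C)
  then obtain s where s': "\<forall>e. e \<notin> ?J \<longrightarrow> s e = s0 e"
    "\<forall>e\<in>?J. s e < K \<and> s e \<notin> ?X e \<and> (\<forall>f\<in>?N e. s f \<noteq> s e)"
    by (elim exE conjE)
  have s: "s e = s0 e" if "\<not> isolated e" for e using s'(1) that by simp
  have s_isolated: "s e < K" "s e \<notin> ?X e" "f \<in> ?N e \<Longrightarrow> s f \<noteq> s e" if "isolated e" for e f
  proof -
    have "e \<in> ?J" using that by simp
    note * = bspec[OF s'(2) this]
    show "s e < K" by (rule conjunct1[OF *])
    show "s e \<notin> ?X e" by (rule conjunct1[OF conjunct2[OF *]])
    show "s f \<noteq> s e" if "f \<in> ?N e" by (rule bspec[OF conjunct2[OF conjunct2[OF *]] that])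
  qed
  have differ: "s {p ! i, p ! Suc i} \<noteq> s {p ! j, p ! Suc j}"
    if "internal {p ! i, p ! Suc i}" "internal {p ! j, p ! Suc j}" "Suc i < m" "Suc j < m"
      "par (p ! i) = par (p ! j)" "i mod 3 \<noteq> j mod 3"
      "\<not> isolated {p ! i, p ! Suc i}" "\<not> isolated {p ! j, p ! Suc j}" for i j
    using s0(2)[OF that(1-6)] s that(7,8) by simp
  have adjacent: "\<exists>i j. Suc i < m \<and> Suc j < m \<and> e = {p ! i, p ! Suc i} \<and> f = {p ! j, p ! Suc j} \<and>
      par (p ! i) = par (p ! j) \<and> (i = Suc j \<or> j = Suc i)"
    if ef: "internal e" "internal f" "e \<noteq> f" "e \<inter> f \<noteq> {}" for e f
  proof -
    obtain i where i: "Suc i < m" "e = {p ! i, p ! Suc i}" using internal_index[OF ef(1)] .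
    obtain j where j: "Suc j < m" "f = {p ! j, p ! Suc j}" using internal_index[OF ef(2)] .
    obtain v where "v \<in> e" "v \<in> f" using ef(4) by blast
    then have "par (p ! i) = par (p ! j)"
      using internal_par[OF ef(1), of "p ! i" v] internal_par[OF ef(2), of v "p ! j"] i j by simp
    moreover have "i = Suc j \<or> j = Suc i" using ef(3,4) i j by (auto simp: nth_inj)
    ultimately show ?thesis using i j by blast
  qed
  have not_isolated: "\<not> isolated e" "\<not> isolated f"
    if "internal e" "internal f" "e \<noteq> f" "e \<inter> f \<noteq> {}" for e f
    using that isolatedD(2) by blast+
  show ?thesis
  proof (rule that[of s])
    show "s e < K" if "internal e" "v \<in> e" for e v
      using s s_isolated(1) s0(1)[OF that] by metis
    show "c t \<noteq> s e" if "internal e" "v \<in> e" "t \<in> T" "par v \<in> t" for e v t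
    proof (cases "isolated e")
      case True
      have "c t \<in> ?X e" using that by (intro imageI) blast
      then show ?thesis using s_isolated(2)[OF True] by metis
    next
      case False
      have "c t \<in> c ` {t \<in> T. par v \<in> t}" using that by (intro imageI) simp
      then show ?thesis using s[OF False] s0(1)[OF that(1,2)] by metis
    qed
    show "s e \<noteq> s f" if ef: "internal e" "internal f" "e \<noteq> f" "e \<inter> f \<noteq> {}" for e f
    proof -
      obtain i j where ij: "Suc i < m" "Suc j < m" "e = {p ! i, p ! Suc i}" "f = {p ! j, p ! Suc j}"
        "par (p ! i) = par (p ! j)" "i = Suc j \<or> j = Suc i"
        using adjacent[OF ef] by (elim exE conjE) (rule that)
      have mod: "i mod 3 \<noteq> j mod 3" by (rule mod_3_differ) (use ij(6) in auto)
      note ef' = ef[unfolded ij(3,4)]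
      show ?thesis
        unfolding ij(3,4) by (rule differ[OF ef'(1,2) ij(1,2,5) mod not_isolated[OF ef']])
    qed
    show "s {w, x} \<noteq> s {y, z}"
      if e: "internal {w, x}" "internal {x, y}" "internal {y, z}" "w \<noteq> y" "x \<noteq> z" for w x y z
    proof -
      have two: "w \<noteq> x" "x \<noteq> y" "y \<noteq> z"
        using e(1-3) internalD(1) C_edge_pair(2) by fastforce+
      have 1: "{w, x} \<noteq> {x, y}" "{w, x} \<inter> {x, y} \<noteq> {}"
        and 2: "{y, z} \<noteq> {x, y}" "{y, z} \<inter> {x, y} \<noteq> {}"
        using e(4,5) two by (auto simp: doubleton_eq_iff)
      obtain i j where ij: "Suc i < m" "Suc j < m" "{w, x} = {p ! i, p ! Suc i}"
        "{x, y} = {p ! j, p ! Suc j}" "par (p ! i) = par (p ! j)" "i = Suc j \<or> j = Suc i"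
        using adjacent[OF e(1,2) 1] by (elim exE conjE) (rule that)
      obtain k j' where kj: "Suc k < m" "Suc j' < m" "{y, z} = {p ! k, p ! Suc k}"
        "{x, y} = {p ! j', p ! Suc j'}" "par (p ! k) = par (p ! j')" "k = Suc j' \<or> j' = Suc k"
        using adjacent[OF e(3,2) 2] by (elim exE conjE) (rule that)
      have j': "j' = j"
        using ij(2) kj(2) trans[OF ij(4)[symmetric] kj(4)] by (auto simp: doubleton_eq_iff nth_inj)
      have "{w, x} \<noteq> {y, z}" using e(4,5) two by (auto simp: doubleton_eq_iff)
      then have "i \<noteq> k" unfolding ij(3) kj(3) by metis
      then have mod: "i mod 3 \<noteq> k mod 3"
        by (rule mod_3_differ) (use ij(6) kj(6) in \<open>auto simp: j'\<close>)
      have par_eq: "par (p ! i) = par (p ! k)" using ij(5) kj(5) unfolding j' by (rule trans[OF _ sym])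
      show ?thesis
        unfolding ij(3) kj(3)
        by (rule differ[OF e(1)[unfolded ij(3)] e(3)[unfolded kj(3)] ij(1) kj(1) par_eq mod])
          (use not_isolated(1)[OF e(1,2) 1] not_isolated(1)[OF e(3,2) 2] in \<open>unfold ij(3) kj(3)\<close>)
    qed
    show "c t \<noteq> s e" if "isolated e" "g \<in> C" "g \<inter> e \<noteq> {}" "t \<in> T" "t \<inter> g \<noteq> {}" for e g t
    proof -
      have "c t \<in> ?X e" using that by (intro imageI) blast
      then show ?thesis using s_isolated(2)[OF that(1)] by metis
    qed
    show "s f \<noteq> s e"
      if "isolated e" "g \<in> C" "g \<inter> e \<noteq> {}" "f \<in> C" "f \<inter> e = {}" "f \<inter> g \<noteq> {}" for e g f
      using s_isolated(3)[OF that(1)] that by blast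
  qed
qed

text \<open>The tree keeps its coloring, internal edges take the coloring above, and boundary edges take the
  color \<open>K\<close>. A bicolored walk that uses \<open>K\<close> would contain an isolated edge between two boundary edges,
  whose color was chosen to differ from those of the edges at the far ends of the two. In a bicolored walk without \<open>K\<close>, an internal edge would
  share its color with an edge two steps further on the walk; such an edge is a tree edge at the
  common neighbour \<open>u\<close> of the family or the next internal edge but one, and both have other colors.\<close>

theorem star_coloring_with_cycle:
  "\<exists>col. proper_edge_coloring (T \<union> C) (Suc K) col \<and> no_bicolored_walk (T \<union> C) col"
proof (rule internal_coloring)
  fix s :: "'a set \<Rightarrow> nat"
  assume s_less: "\<And>e v. internal e \<Longrightarrow> v \<in> e \<Longrightarrow> s e < K"
    and s_T: "\<And>e v t. internal e \<Longrightarrow> v \<in> e \<Longrightarrow> t \<in> T \<Longrightarrow> par v \<in> t \<Longrightarrow> c t \<noteq> s e"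
    and s_adj: "\<And>e f. internal e \<Longrightarrow> internal f \<Longrightarrow> e \<noteq> f \<Longrightarrow> e \<inter> f \<noteq> {} \<Longrightarrow> s e \<noteq> s f"
    and s_path: "\<And>w x y z. internal {w, x} \<Longrightarrow> internal {x, y} \<Longrightarrow> internal {y, z} \<Longrightarrow> w \<noteq> y \<Longrightarrow> x \<noteq> z \<Longrightarrow>
      s {w, x} \<noteq> s {y, z}"
    and s_iso_T: "\<And>e g t. isolated e \<Longrightarrow> g \<in> C \<Longrightarrow> g \<inter> e \<noteq> {} \<Longrightarrow> t \<in> T \<Longrightarrow> t \<inter> g \<noteq> {} \<Longrightarrow> c t \<noteq> s e"
    and s_iso_C: "\<And>e g f. isolated e \<Longrightarrow> g \<in> C \<Longrightarrow> g \<inter> e \<noteq> {} \<Longrightarrow> f \<in> C \<Longrightarrow> f \<inter> e = {} \<Longrightarrow> f \<inter> g \<noteq> {} \<Longrightarrow>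
      s f \<noteq> s e"
  let ?E = "T \<union> C"
  define col where "col e = (if e \<in> T then c e else if internal e then s e else K)" for e
  have C_not_T: "e \<notin> T" if e: "e \<in> C" for e
  proof
    assume "e \<in> T"
    obtain v w where vw: "e = {v, w}" using C_edge_pair(2)[OF e] by (auto simp: card_2_iff)
    then have v: "v \<in> set p" using C_edge_pair(1)[OF e] by simp
    then have "par v \<in> e" using leaf_edge[OF v \<open>e \<in> T\<close>] vw by simp
    then show False using C_edge_pair(1)[OF e] par_inner[OF v] by blast
  qed
  have col_T: "col e = c e" "c e < K" if "e \<in> T" for e
    using that properT unfolding col_def proper_edge_coloring_def by auto
  have col_I: "col e = s e" "s e < K" if e: "internal e" for e
  proof -
    show "col e = s e" using C_not_T internalD(1)[OF e] e unfolding col_def by simp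
    have "e \<noteq> {}" using C_edge_pair(2)[OF internalD(1)[OF e]] by force
    then show "s e < K" using s_less[OF e] by blast
  qed
  have col_B: "col e = K" if "e \<in> C" "\<not> internal e" for e
    using that C_not_T unfolding col_def by simp
  have boundary: "e \<in> C \<and> \<not> internal e" if "e \<in> ?E" "col e = K" for e
    using that col_T[of e] col_I[of e] by fastforce
  have ends_in: "x \<in> set p" "y \<in> set p" if "{x, y} \<in> C" for x y
    using C_edge_pair(1)[OF that] by auto
  have T_leaf: "y = par x" if "{x, y} \<in> T" "x \<in> set p" for x y
    using leaf_edge[OF that(2,1)] cardT[OF that(1)] by (auto simp: doubleton_eq_iff)
  have distinct_ends: "x \<noteq> y" if "{x, y} \<in> ?E" for x y
    using that cardT[of "{x, y}"] C_edge_pair(2)[of "{x, y}"] by auto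
  have T_C: "col e \<noteq> col f" if ef: "e \<in> T" "f \<in> C" "v \<in> e" "v \<in> f" for e f v
  proof (cases "internal f")
    case True
    have "v \<in> set p" using C_edge_pair(1)[OF ef(2)] ef(4) by blast
    then have "par v \<in> e" using leaf_edge[of v e] ef by auto
    then show ?thesis using s_T[OF True ef(4) ef(1)] col_T ef(1) col_I(1)[OF True] by simp
  next
    case False
    then show ?thesis using col_B ef(2) col_T[OF ef(1)] by simp
  qed
  have proper: "col e \<noteq> col f" if ef: "e \<in> ?E" "f \<in> ?E" "e \<noteq> f" "v \<in> e" "v \<in> f" for e f v
  proof -
    consider "e \<in> T" "f \<in> T" | "e \<in> T" "f \<in> C" | "e \<in> C" "f \<in> T"
      | "internal e" "internal f" | "internal e" "f \<in> C" "\<not> internal f"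
      | "e \<in> C" "\<not> internal e" "internal f" | "e \<in> C" "\<not> internal e" "f \<in> C" "\<not> internal f"
      using ef(1,2) by blast
    then show ?thesis
    proof cases
      case 1
      then have "c e \<noteq> c f" using properT ef(3-5) unfolding proper_edge_coloring_def by blast
      then show ?thesis using col_T 1 by simp
    next
      case 2
      then show ?thesis using T_C ef by blast
    next
      case 3
      then show ?thesis using T_C[OF 3(2,1) ef(5,4)] by simp
    next
      case 4
      then show ?thesis using s_adj[OF 4 ef(3)] ef(4,5) col_I by auto
    next
      case 5
      then show ?thesis using col_I[of e] col_B[of f] by simp
    next
      case 6
      then show ?thesis using col_I[of f] col_B[of e] by simp
    next
      case 7
      then show ?thesis using boundary_unique ef(3-5) by blast
    qed
  qed
  \<comment> \<open>An internal edge at the end of three consecutive walk edges, none of color K.\<close>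
  have inner_walk: "col {x, y} \<noteq> col {z, w}"
    if walk: "{x, y} \<in> C" "{y, z} \<in> ?E" "{z, w} \<in> ?E" "x \<noteq> z" "y \<noteq> w"
      and no_K: "col {x, y} \<noteq> K" "col {y, z} \<noteq> K" "col {z, w} \<noteq> K" for x y z w
  proof -
    have xy: "internal {x, y}" using col_B[OF walk(1)] no_K by blast
    have y: "y \<in> set p" using ends_in[OF walk(1)] by simp
    have at_parent: ?thesis if "{z, w} \<in> T" "par y \<in> {z, w}"
      using s_T[OF xy, of y "{z, w}"] that col_T(1)[OF that(1)] col_I(1)[OF xy] by simp
    show ?thesis
    proof (cases "{y, z} \<in> T")
      case True
      then have z: "z = par y" using T_leaf y by blast
      then have "{z, w} \<in> T" using ends_in(1)[of z w] par_inner[OF y] walk(3) by blast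
      then show ?thesis using at_parent z by blast
    next
      case False
      then have yz: "internal {y, z}" using walk(2) col_B no_K(2) by blast
      show ?thesis
      proof (cases "{z, w} \<in> T")
        case True
        have "z \<in> set p" using ends_in internalD(1)[OF yz] by blast
        then have "w = par y" using T_leaf[OF True] internal_par[OF yz, of y z] by simp
        then show ?thesis using at_parent True by blast
      next
        case False
        then have zw: "internal {z, w}" using walk(3) col_B no_K(3) by blast
        show ?thesis using s_path[OF xy yz zw walk(4,5)] col_I(1) xy zw by simp
      qed
    qed
  qed
  \<comment> \<open>Two boundary edges on the walk force the edge between them to be isolated.\<close>
  have boundary_walk: "col {x2, x3} \<noteq> col {x4, x5}"
    if walk: "{x1, x2} \<in> ?E" "{x2, x3} \<in> ?E" "{x3, x4} \<in> ?E" "{x4, x5} \<in> ?E"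
        "x1 \<noteq> x3" "x2 \<noteq> x4" "x3 \<noteq> x5"
      and K: "col {x1, x2} = K" "col {x3, x4} = K" for x1 x2 x3 x4 x5
  proof
    assume eq: "col {x2, x3} = col {x4, x5}"
    have b12: "{x1, x2} \<in> C" "\<not> internal {x1, x2}" using boundary[OF walk(1) K(1)] by auto
    have b34: "{x3, x4} \<in> C" "\<not> internal {x3, x4}" using boundary[OF walk(3) K(2)] by auto
    have L: "x2 \<in> set p" "x3 \<in> set p" using ends_in[OF b12(1)] ends_in[OF b34(1)] by auto
    have "{x2, x3} \<notin> T" using T_leaf[of x2 x3] par_inner[OF L(1)] L by auto
    then have C23: "{x2, x3} \<in> C" using walk(2) by blast
    have ne: "{x1, x2} \<noteq> {x2, x3}" "{x3, x4} \<noteq> {x2, x3}"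
      using walk(5,6) by (auto simp: doubleton_eq_iff)
    have i23: "internal {x2, x3}"
      using boundary_unique[OF b12(1) C23 b12(2), of x2] ne(1) by blast
    have iso: "isolated {x2, x3}"
      unfolding isolated_def
    proof (intro conjI allI impI i23)
      fix f assume f: "internal f" "f \<inter> {x2, x3} \<noteq> {}"
      show "f = {x2, x3}"
      proof (rule ccontr)
        assume nf: "f \<noteq> {x2, x3}"
        obtain a where a: "\<And>f. f \<in> C \<Longrightarrow> x2 \<in> f \<Longrightarrow> f \<noteq> {x2, x3} \<Longrightarrow> f = {x2, a}"
          using other_edge[OF L(1) C23] by blast
        obtain b where b: "\<And>f. f \<in> C \<Longrightarrow> x3 \<in> f \<Longrightarrow> f \<noteq> {x2, x3} \<Longrightarrow> f = {x3, b}"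
          using other_edge[OF L(2) C23] by blast
        have "f = {x1, x2} \<or> f = {x3, x4}"
          using a[of f] a[OF b12(1)] b[of f] b[OF b34(1)] internalD(1)[OF f(1)] f(2) nf ne by auto
        then show False using f(1) b12(2) b34(2) by blast
      qed
    qed
    have not_K: "col {x4, x5} \<noteq> K" using eq col_I[OF i23] by simp
    have "{x4, x5} \<notin> T"
    proof
      assume t: "{x4, x5} \<in> T"
      have "c {x4, x5} \<noteq> s {x2, x3}" by (rule s_iso_T[OF iso b34(1) _ t]) auto
      then show False using eq col_T(1)[OF t] col_I(1)[OF i23] by simp
    qed
    then have C45: "{x4, x5} \<in> C" using walk(4) by blast
    then have i45: "internal {x4, x5}" using col_B not_K by blast
    show False
    proof (cases "{x4, x5} \<inter> {x2, x3} = {}")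
      case True
      have "s {x4, x5} \<noteq> s {x2, x3}" by (rule s_iso_C[OF iso b34(1) _ C45 True]) auto
      then show False using eq col_I(1) i23 i45 by simp
    next
      case False
      have "{x4, x5} \<noteq> {x2, x3}"
        using walk(6) distinct_ends[OF walk(3)] by (auto simp: doubleton_eq_iff)
      then show False using s_adj[OF i45 i23] False eq col_I(1) i23 i45 by simp
    qed
  qed
  have "no_bicolored_walk ?E col"
    unfolding no_bicolored_walk_def
  proof (intro allI impI notI)
    fix x1 x2 x3 x4 x5
    assume walk: "{x1, x2} \<in> ?E" "{x2, x3} \<in> ?E" "{x3, x4} \<in> ?E" "{x4, x5} \<in> ?E"
        "x1 \<noteq> x3" "x2 \<noteq> x4" "x3 \<noteq> x5"
      and eq: "col {x1, x2} = col {x3, x4}" "col {x2, x3} = col {x4, x5}"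
    have rev: "{x5, x4} \<in> ?E" "{x4, x3} \<in> ?E" "{x3, x2} \<in> ?E" "{x2, x1} \<in> ?E"
      "col {x5, x4} = col {x3, x2}" "col {x4, x3} = col {x2, x1}"
      using walk eq by (simp_all add: insert_commute)
    have no_K: "col {x1, x2} \<noteq> K" "col {x2, x3} \<noteq> K"
    proof
      show False if "col {x1, x2} = K"
        using boundary_walk[OF walk that] that eq by simp
      show "col {x2, x3} \<noteq> K"
      proof
        assume K: "col {x2, x3} = K"
        have "col {x4, x3} \<noteq> col {x2, x1}"
          by (rule boundary_walk[OF rev(1-4)]) (use walk(5-7) K eq in \<open>auto simp: insert_commute\<close>)
        then show False using rev(6) by simp
      qed
    qed
    note no_K = no_K no_K[unfolded eq]
    have rev_no_K: "col {x5, x4} \<noteq> K" "col {x4, x3} \<noteq> K" "col {x3, x2} \<noteq> K" "col {x2, x1} \<noteq> K"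
      using no_K by (simp_all add: insert_commute)
    have "{x1, x2} \<in> T"
      using inner_walk[OF _ walk(2,3,5,6)] no_K eq(1) walk(1) by blast
    moreover have "{x2, x3} \<in> T"
      using inner_walk[OF _ walk(3,4,6,7)] no_K eq(2) walk(2) by blast
    moreover have "{x4, x3} \<in> T"
      using inner_walk[OF _ rev(3,4), of x4] rev_no_K rev(2,6) walk(5,6) by blast
    moreover have "{x5, x4} \<in> T"
      using inner_walk[OF _ rev(2,3), of x5] rev_no_K rev(1,5) walk(6,7) by blast
    ultimately have T: "{x1, x2} \<in> T" "{x2, x3} \<in> T" "{x3, x4} \<in> T" "{x4, x5} \<in> T"
      by (simp_all add: insert_commute)
    then have "c {x1, x2} = c {x3, x4}" "c {x2, x3} = c {x4, x5}"
      using eq col_T(1) by simp_all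
    then show False using starT T walk(5-7) unfolding no_bicolored_walk_def by blast
  qed
  moreover have "proper_edge_coloring ?E (Suc K) col"
    unfolding proper_edge_coloring_def
  proof (intro conjI ballI impI)
    have "col e < Suc K" if "e \<in> ?E" for e
      using that col_T[of e] col_I[of e] col_B[of e] by fastforce
    then show "col ` ?E \<subseteq> {..<Suc K}" by blast
    show "col e \<noteq> col f" if "e \<in> ?E" "f \<in> ?E" "e \<noteq> f" "e \<inter> f \<noteq> {}" for e f
      using proper that by blast
  qed
  ultimately show ?thesis by blast
qed

end


section \<open>The characteristic tree of a complete Halin graph\<close>

lemma degree_eq_card_neighbours:
  assumes "\<And>e. e \<in> E \<Longrightarrow> card e = 2"
  shows "degree E v = card {w. {v, w} \<in> E}"
proof -
  have "{e \<in> E. v \<in> e} = (\<lambda>w. {v, w}) ` {w. {v, w} \<in> E}"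
  proof (intro equalityI subsetI)
    fix e assume e: "e \<in> {e \<in> E. v \<in> e}"
    then have "card e = 2" using assms by blast
    then obtain x y where "e = {x, y}" by (auto simp: card_2_iff)
    then show "e \<in> (\<lambda>w. {v, w}) ` {w. {v, w} \<in> E}"
      using e by (auto simp: insert_commute)
  qed auto
  moreover have "inj_on (\<lambda>w. {v, w}) {w. {v, w} \<in> E}"
    by (auto simp: inj_on_def doubleton_eq_iff)
  ultimately show ?thesis by (simp add: degree_def card_image)
qed

lemma interior_path_neighbours:
  assumes "distinct q" "v \<in> set q" "v \<noteq> hd q" "v \<noteq> last q"
  obtains a b where "a \<noteq> b" "a \<in> set q" "b \<in> set q" "{v, a} \<in> path_edges q" "{v, b} \<in> path_edges q"
proof -
  obtain as bs where q: "q = as @ v # bs" using split_list[OF assms(2)] by blast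
  obtain as' a where as: "as = as' @ [a]" using q assms(3) by (cases as rule: rev_cases) auto
  obtain b bs' where bs: "bs = b # bs'" using q assms(4) by (cases bs) auto
  have "{v, a} \<in> path_edges q" "{v, b} \<in> path_edges q"
    unfolding q as bs using path_edges_append[of "as' @ [a]" v "b # bs'"]
      path_edges_snoc[of "as' @ [a]" v] by (auto simp: insert_commute)
  then show ?thesis using that[of a b] assms(1) unfolding q as bs by auto
qed

text \<open>The characteristic tree of a complete Halin graph, with all leaves at the distance \<open>d\<close> from \<open>r\<close>.\<close>

locale level_tree =
  fixes V :: "'a set" and T :: "'a set set" and r :: 'a and d :: nat
  assumes tree: "tree V T" and r: "r \<in> V"
    and inner_degree: "\<And>v. v \<in> V - leaves V T \<Longrightarrow> 3 \<le> degree T v"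
    and level: "\<And>l. l \<in> leaves V T \<Longrightarrow> graph_dist V T r l = d"
    and leaf_exists: "leaves V T \<noteq> {}"
begin

abbreviation "L \<equiv> leaves V T"
abbreviation "dep \<equiv> graph_dist V T r"

definition par :: "'a \<Rightarrow> 'a" where
  "par l = (THE u. {l, u} \<in> T)"

lemma finite_V: "finite V" and edge_subset: "e \<in> T \<Longrightarrow> e \<subseteq> V" and edge_card: "e \<in> T \<Longrightarrow> card e = 2"
  using tree by (auto simp: tree_def simple_graph_def)

lemma degree_T: "degree T v = card {w. {v, w} \<in> T}"
  by (rule degree_eq_card_neighbours) (rule edge_card)

lemma edge_verts: "{x, y} \<in> T \<Longrightarrow> x \<in> V" "{x, y} \<in> T \<Longrightarrow> y \<in> V" "{x, y} \<in> T \<Longrightarrow> x \<noteq> y"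
  using edge_subset[of "{x, y}"] edge_card[of "{x, y}"] by auto

lemma finite_T: "finite T"
  using edge_subset finite_V finite_subset[of T "Pow V"] by auto

lemma finite_neighbours: "finite {w. {v, w} \<in> T}"
  using edge_verts(2) finite_V finite_subset[of "{w. {v, w} \<in> T}" V] by blast

lemma dep_root: "dep r = 0"
  and dep_edge: "{x, y} \<in> T \<Longrightarrow> dep x = Suc (dep y) \<or> dep y = Suc (dep x)"
  and dep_parent: "v \<in> V \<Longrightarrow> v \<noteq> r \<Longrightarrow> \<exists>!w. {v, w} \<in> T \<and> dep v = Suc (dep w)"
  using tree_depth[OF tree r] by blast+

lemma parent_unique: "{v, w} \<in> T \<Longrightarrow> {v, w'} \<in> T \<Longrightarrow> dep v = Suc (dep w) \<Longrightarrow> dep v = Suc (dep w') \<Longrightarrow> w = w'"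
  using dep_parent[of v] dep_root edge_verts(1)[of v w] by (metis nat.distinct(1))

lemma leafI:
  assumes v: "v \<in> V" and top: "\<And>w. w \<in> V \<Longrightarrow> dep w \<le> dep v"
  shows "v \<in> L"
proof -
  have "w = w'" if w: "{v, w} \<in> T" "{v, w'} \<in> T" for w w'
  proof -
    have "dep v = Suc (dep w)" "dep v = Suc (dep w')"
      using dep_edge[OF w(1)] dep_edge[OF w(2)] top[OF edge_verts(2)[OF w(1)]]
        top[OF edge_verts(2)[OF w(2)]] by auto
    then show ?thesis using parent_unique w by blast
  qed
  then have "card {w. {v, w} \<in> T} \<le> Suc 0"
    by (subst card_le_Suc0_iff_eq[OF finite_neighbours]) blast
  then have "degree T v \<le> 1" unfolding degree_T by simp
  then show ?thesis using inner_degree[of v] v by fastforce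
qed

text \<open>A vertex of maximal depth has no children and is thus a leaf. Hence the maximal depth is \<open>d\<close>, the
  leaves are exactly the vertices of depth \<open>d\<close>, and their neighbours have depth \<open>d - 1\<close>.\<close>

lemma dep_le: "v \<in> V \<Longrightarrow> dep v \<le> d"
proof -
  assume v: "v \<in> V"
  have fin: "finite (dep ` V)" "dep ` V \<noteq> {}" using finite_V r by auto
  obtain w where w: "w \<in> V" "dep w = Max (dep ` V)" using Max_in[OF fin] by auto
  have top: "dep x \<le> dep w" if "x \<in> V" for x
    using that w(2) Max_ge[OF fin(1)] by simp
  then show "dep v \<le> d" using level[OF leafI[OF w(1) top]] v by metis
qed

lemma leaf_iff: "v \<in> V \<Longrightarrow> v \<in> L \<longleftrightarrow> dep v = d"
  using leafI dep_le level by blast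

lemma children:
  assumes v: "v \<in> V" "v \<notin> L"
  shows "2 \<le> card {w. {v, w} \<in> T \<and> dep w = Suc (dep v)}"
proof -
  let ?up = "{w. {v, w} \<in> T \<and> dep v = Suc (dep w)}"
  let ?down = "{w. {v, w} \<in> T \<and> dep w = Suc (dep v)}"
  have fin: "finite ?up" "finite ?down"
    using finite_neighbours[of v] by (auto intro: finite_subset)
  have "{w. {v, w} \<in> T} = ?up \<union> ?down" using dep_edge by blast
  moreover have "3 \<le> card {w. {v, w} \<in> T}"
    using inner_degree[of v] v unfolding degree_T by blast
  ultimately have "3 \<le> card (?up \<union> ?down)" by (simp only:)
  also have "\<dots> \<le> card ?up + card ?down" by (rule card_Un_le)
  also have "card ?up \<le> Suc 0"
    using parent_unique by (subst card_le_Suc0_iff_eq[OF fin(1)]) blast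
  finally show ?thesis by simp
qed

lemma leaf_neighbour:
  assumes l: "l \<in> L"
  shows par_edge: "{l, par l} \<in> T" and neighbour_par: "{l, w} \<in> T \<Longrightarrow> w = par l"
    and dep_par: "Suc (dep (par l)) = d"
proof -
  have lV: "l \<in> V" and "degree T l = 1" using l unfolding leaves_def by auto
  then have "card {w. {l, w} \<in> T} = 1" unfolding degree_T by simp
  then obtain u where u: "{w. {l, w} \<in> T} = {u}" by (auto simp: card_1_singleton_iff)
  then have "par l = u" unfolding par_def by (intro the_equality) auto
  then show edge: "{l, par l} \<in> T" and "{l, w} \<in> T \<Longrightarrow> w = par l" using u by auto
  show "Suc (dep (par l)) = d"
    using dep_edge[OF edge] level[OF l] dep_le[OF edge_verts(2)[OF edge]] by auto
qed

lemma par_inner: "l \<in> L \<Longrightarrow> par l \<in> V \<and> par l \<notin> L"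
  using dep_par par_edge edge_verts(2) leaf_iff by (metis n_not_Suc_n)

lemma par_eqI: "l \<in> L \<Longrightarrow> {u, l} \<in> T \<Longrightarrow> par l = u"
  using neighbour_par by (metis insert_commute)

text \<open>All children of \<open>par l\<close> have depth \<open>d\<close> and are leaves; only its parent can be an inner vertex.\<close>

lemma inner_neighbour_unique:
  assumes l: "l \<in> L" and w: "{par l, w} \<in> T" "{par l, w'} \<in> T" "w \<notin> L" "w' \<notin> L"
  shows "w = w'"
proof -
  have up: "dep (par l) = Suc (dep w)" if "{par l, w} \<in> T" "w \<notin> L" for w
    using dep_edge[OF that(1)] dep_par[OF l] leaf_iff[OF edge_verts(2)[OF that(1)]] that(2) by auto
  show ?thesis using parent_unique[OF w(1,2)] up w by blast
qed

lemma leaf_children: "l \<in> L \<Longrightarrow> 2 \<le> card {w \<in> L. par w = par l}"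
proof -
  assume l: "l \<in> L"
  have "w \<in> L \<and> par w = par l" if "{par l, w} \<in> T" "dep w = Suc (dep (par l))" for w
    using that dep_par[OF l] leaf_iff[OF edge_verts(2)[OF that(1)]] par_eqI by auto
  then have "{w. {par l, w} \<in> T \<and> dep w = Suc (dep (par l))} \<subseteq> {w \<in> L. par w = par l}" by blast
  then have "card {w. {par l, w} \<in> T \<and> dep w = Suc (dep (par l))} \<le> card {w \<in> L. par w = par l}"
    using finite_V by (intro card_mono) (auto simp: leaves_def)
  then show "2 \<le> card {w \<in> L. par w = par l}" using children[of "par l"] par_inner[OF l] by simp
qed

lemma par_degree: "l \<in> L \<Longrightarrow> degree T (par l) \<le> Suc (card {w \<in> L. par w = par l})"
proof -
  assume l: "l \<in> L"
  have fin: "finite {w \<in> L. par w = par l}" "finite {w. {par l, w} \<in> T \<and> w \<notin> L}"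
    using finite_V finite_neighbours[of "par l"] by (auto simp: leaves_def)
  have "{w. {par l, w} \<in> T} \<subseteq> {w \<in> L. par w = par l} \<union> {w. {par l, w} \<in> T \<and> w \<notin> L}"
    using par_eqI by blast
  then have "card {w. {par l, w} \<in> T} \<le> card ({w \<in> L. par w = par l} \<union> {w. {par l, w} \<in> T \<and> w \<notin> L})"
    using fin by (intro card_mono) auto
  also have "\<dots> \<le> card {w \<in> L. par w = par l} + card {w. {par l, w} \<in> T \<and> w \<notin> L}"
    by (rule card_Un_le)
  also have "card {w. {par l, w} \<in> T \<and> w \<notin> L} \<le> Suc 0"
    using inner_neighbour_unique[OF l] by (subst card_le_Suc0_iff_eq[OF fin(2)]) blast
  finally show "degree T (par l) \<le> Suc (card {w \<in> L. par w = par l})"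
    unfolding degree_T by simp
qed

text \<open>Suppose that all leaves are adjacent to \<open>u\<close>. If \<open>u\<close> is the root, then the tree is a star. Otherwise
  the parent of \<open>u\<close> has a second child, which has children of its own, and these are leaves.\<close>

lemma two_leaf_parents:
  assumes not_star: "\<not> star V T"
  obtains l l' where "l \<in> L" "l' \<in> L" "par l \<noteq> par l'"
proof -
  obtain l where l: "l \<in> L" using leaf_exists by blast
  have "\<exists>l' \<in> L. par l' \<noteq> par l"
  proof (rule ccontr)
    assume "\<not> (\<exists>l' \<in> L. par l' \<noteq> par l)"
    then have same: "par l' = par l" if "l' \<in> L" for l' using that by blast
    show False
    proof (cases "par l = r")
      case True
      then have d: "d = 1" using dep_par[OF l] dep_root by simp
      have zero: "x = r" if "x \<in> V" "dep x = 0" for x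
        using dep_parent[OF that(1)] that(2) by force
      have "T = {{r, v} | v. v \<in> V - {r}}"
      proof (intro equalityI subsetI)
        fix e assume e: "e \<in> T"
        then obtain x y where xy: "e = {x, y}" using edge_card[OF e] by (auto simp: card_2_iff)
        note V = edge_verts[OF e[unfolded xy]]
        have "dep x = 0 \<or> dep y = 0"
          using dep_edge[OF e[unfolded xy]] dep_le[OF V(1)] dep_le[OF V(2)] d by auto
        then have "x = r \<or> y = r" using zero V by blast
        then show "e \<in> {{r, v} | v. v \<in> V - {r}}" using V xy by (auto simp: insert_commute)
      next
        fix e assume "e \<in> {{r, v} | v. v \<in> V - {r}}"
        then obtain v where v: "e = {r, v}" "v \<in> V" "v \<noteq> r" by blast
        then have "v \<in> L" using leaf_iff[OF v(2)] dep_le[OF v(2)] zero[OF v(2)] d by auto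
        then show "e \<in> T" using par_edge[of v] same[of v] True v(1) by (simp add: insert_commute)
      qed
      then show False using not_star r unfolding star_def by blast
    next
      case False
      note u = par_inner[OF l]
      obtain x where x: "{par l, x} \<in> T" "dep (par l) = Suc (dep x)"
        using dep_parent[OF _ False] u by blast
      have xV: "x \<in> V" using edge_verts(2)[OF x(1)] .
      have "x \<notin> L" using leaf_iff[OF xV] dep_par[OF l] x(2) by simp
      then have "2 \<le> card {w. {x, w} \<in> T \<and> dep w = Suc (dep x)}" using children[OF xV] by simp
      then have "\<not> {w. {x, w} \<in> T \<and> dep w = Suc (dep x)} \<subseteq> {par l}"
        using card_mono[of "{par l}" "{w. {x, w} \<in> T \<and> dep w = Suc (dep x)}"] by auto
      then obtain u' where u': "{x, u'} \<in> T" "dep u' = Suc (dep x)" "u' \<noteq> par l" by blast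
      have u'V: "u' \<in> V" using edge_verts(2)[OF u'(1)] .
      have "u' \<notin> L" using leaf_iff[OF u'V] dep_par[OF l] x(2) u'(2) by simp
      then have "{w. {u', w} \<in> T \<and> dep w = Suc (dep u')} \<noteq> {}"
        using children[OF u'V] by force
      then obtain w where w: "{u', w} \<in> T" "dep w = Suc (dep u')" by blast
      then have "w \<in> L" using leaf_iff[OF edge_verts(2)[OF w(1)]] dep_par[OF l] x(2) u'(2) by simp
      then show False using same par_eqI[OF _ w(1)] u'(3) by metis
    qed
  qed
  then show ?thesis using that l by metis
qed

text \<open>A path between foreign leaves could enter a leaf adjacent to \<open>par l\<close> only at its end, and could pass
  through \<open>par l\<close> only between two inner neighbours, of which there is at most one.\<close>

lemma path_around_parent:
  assumes l: "l \<in> L" and xy: "x \<in> L" "y \<in> L" "par x \<noteq> par l" "par y \<noteq> par l"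
  obtains q where "graph_path V T q" "hd q = x" "last q = y" "par l \<notin> set q"
    "\<forall>a \<in> L. par a = par l \<longrightarrow> a \<notin> set q"
proof -
  have "x \<in> V" "y \<in> V" using xy by (auto simp: leaves_def)
  then obtain q where q: "graph_path V T q" "hd q = x" "last q = y"
    using tree unfolding tree_def connected_graph_def by blast
  have dist: "distinct q" and sub: "path_edges q \<subseteq> T" using q(1) by (auto simp: graph_path_def)
  have avoid: "a \<notin> set q" if a: "a \<in> L" "par a = par l" for a
  proof
    assume "a \<in> set q"
    moreover have "a \<noteq> hd q" "a \<noteq> last q" using q a xy by auto
    ultimately obtain b b' where "b \<noteq> b'" "b \<in> set q" "b' \<in> set q"
      "{a, b} \<in> path_edges q" "{a, b'} \<in> path_edges q"
      by (rule interior_path_neighbours[OF dist])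
    then show False using neighbour_par[OF a(1)] subsetD[OF sub] by metis
  qed
  have "par l \<notin> set q"
  proof
    assume u: "par l \<in> set q"
    have "par l \<noteq> hd q" "par l \<noteq> last q" using q xy par_inner[OF l] by auto
    then obtain b b' where b: "b \<noteq> b'" "b \<in> set q" "b' \<in> set q"
      "{par l, b} \<in> path_edges q" "{par l, b'} \<in> path_edges q"
      by (rule interior_path_neighbours[OF dist u])
    note b = b(1-3) subsetD[OF sub b(4)] subsetD[OF sub b(5)]
    then have "b \<notin> L" "b' \<notin> L" using avoid par_eqI by metis+
    then show False using inner_neighbour_unique[OF l b(4,5)] b(1) by blast
  qed
  then show ?thesis using that q avoid by blast
qed

end


section \<open>Order of the leaves along the adjoint cycle\<close>

lemma split_list_at_two:
  assumes "i < k" "k < length p"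
  shows "p = take i p @ p ! i # drop (Suc i) (take k p) @ p ! k # drop (Suc k) p"
proof -
  have "take k p = take i p @ p ! i # drop (Suc i) (take k p)"
    using id_take_nth_drop[of i "take k p"] assms by (simp add: min_def)
  then show ?thesis using id_take_nth_drop[of k p] assms(2) by (metis append.assoc append_Cons)
qed

text \<open>If \<open>p ! j\<close> did not belong to the family of \<open>p ! i\<close> and \<open>p ! k\<close>, then one end of \<open>p\<close> would be a second
  foreign leaf, on the other side of the chord through \<open>p ! i\<close> and \<open>p ! k\<close>. A path of the tree
  joining the two foreign leaves around the chord contradicts \<open>halin_noncrossing\<close>.\<close>

lemma children_contiguous:
  assumes lt: "level_tree V T r d" and halin: "halin_graph V T C pos \<gamma>"
    and p: "distinct p" "cycle_edges p = C" "set p = leaves V T"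
    and ends: "level_tree.par T (p ! 0) \<noteq> level_tree.par T (p ! (length p - 1))"
    and ijk: "i < j" "j < k" "k < length p"
    and par: "level_tree.par T (p ! i) = level_tree.par T (p ! k)"
  shows "level_tree.par T (p ! j) = level_tree.par T (p ! i)"
proof (rule ccontr)
  interpret level_tree V T r d by (rule lt)
  assume neq: "par (p ! j) \<noteq> par (p ! i)"
  define xs where "xs = drop (Suc i) (take k p)"
  define ys where "ys = drop (Suc k) p @ take i p"
  have split: "p = take i p @ p ! i # xs @ p ! k # drop (Suc k) p"
    unfolding xs_def by (rule split_list_at_two) (use ijk in auto)
  have rot: "cycle_edges (p ! i # xs @ p ! k # ys) = C"
    using cycle_edges_rotate[of "take i p" "p ! i # xs @ p ! k # drop (Suc k) p"] p(2)
    by (simp add: ys_def flip: split)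
  have "mset (p ! i # xs @ p ! k # ys) = mset p"
    by (subst (3) split) (simp add: ys_def)
  then have dist: "distinct (p ! i # xs @ p ! k # ys)" and set: "set (p ! i # xs @ p ! k # ys) = set p"
    using p(1) by (metis mset_eq_imp_distinct_iff, metis mset_eq_setD)
  have inL: "p ! t \<in> L" if "t < length p" for t using nth_mem[OF that] unfolding p(3) .
  have L: "p ! i \<in> L" "p ! j \<in> L" "p ! k \<in> L" using inL ijk by auto
  have "xs ! (j - Suc i) = p ! j" "j - Suc i < length xs" using ijk by (auto simp: xs_def)
  then have j: "p ! j \<in> set xs" by (metis nth_mem)
  obtain y where y: "y \<in> set ys" "par y \<noteq> par (p ! i)"
  proof (cases "par (p ! 0) = par (p ! i)")
    case True
    then have last: "par (p ! (length p - 1)) \<noteq> par (p ! i)" using ends by simp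
    then have "k \<noteq> length p - 1" using par by auto
    then have "Suc k < length p" using ijk by simp
    then have "last (drop (Suc k) p) = last p" "drop (Suc k) p \<noteq> []" "p \<noteq> []"
      by (auto simp: last_drop)
    then have "last (drop (Suc k) p) = p ! (length p - 1)" "drop (Suc k) p \<noteq> []"
      by (simp_all add: last_conv_nth)
    then have "p ! (length p - 1) \<in> set ys" unfolding ys_def by (metis UnI1 last_in_set set_append)
    then show ?thesis using that last by blast
  next
    case False
    then have "i \<noteq> 0" by (metis)
    then have "p ! 0 = take i p ! 0" "0 < length (take i p)" using ijk by auto
    then have "p ! 0 \<in> set ys" unfolding ys_def by (metis UnI2 nth_mem set_append)
    then show ?thesis using that False by blast
  qed
  have yL: "y \<in> L" using y(1) set p(3) by auto
  obtain q where q: "graph_path V T q" "hd q = p ! j" "last q = y" "par (p ! i) \<notin> set q"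
    "\<forall>a \<in> L. par a = par (p ! i) \<longrightarrow> a \<notin> set q"
    using path_around_parent[OF L(1,2) yL neq y(2)] .
  show False
  proof (rule halin_noncrossing[OF halin dist rot])
    show "set (p ! i # xs @ p ! k # ys) = leaves V T" using set p(3) by simp
    show "{p ! i, par (p ! i)} \<in> T" "{p ! k, par (p ! i)} \<in> T"
      using par_edge[OF L(1)] par_edge[OF L(3)] par by simp_all
    show "par (p ! i) \<notin> leaves V T" using par_inner[OF L(1)] by simp
    show "graph_path V T q" "hd q \<in> set xs" "last q \<in> set ys" "par (p ! i) \<notin> set q"
      using q j y by simp_all
    show "p ! i \<notin> set q" "p ! k \<notin> set q" using q(5) L par by simp_all
  qed
qed

text \<open>Cutting the cycle at an edge between two families makes every family an interval of the list.\<close>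

lemma rotation_with_different_ends:
  fixes f :: "'a \<Rightarrow> 'b"
  assumes "x \<in> set p" "y \<in> set p" "f x \<noteq> f y"
  obtains p' where "mset p' = mset p" "cycle_edges p' = cycle_edges p"
    "f (p' ! 0) \<noteq> f (p' ! (length p' - 1))"
proof -
  have "\<exists>i. Suc i < length p \<and> f (p ! i) \<noteq> f (p ! Suc i)"
  proof (rule ccontr)
    assume "\<not> ?thesis"
    then have step: "f (p ! Suc i) = f (p ! i)" if "Suc i < length p" for i using that by metis
    have "f (p ! i) = f (p ! 0)" if "i < length p" for i
      using that by (induction i) (auto simp: step)
    then have "f z = f (p ! 0)" if "z \<in> set p" for z using that by (metis in_set_conv_nth)
    then show False using assms by metis
  qed
  then obtain i where i: "Suc i < length p" "f (p ! i) \<noteq> f (p ! Suc i)" by blast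
  let ?p = "drop (Suc i) p @ take (Suc i) p"
  have "?p ! 0 = p ! Suc i" using i(1) by (simp add: nth_append)
  moreover have "?p ! (length ?p - 1) = p ! i"
  proof -
    have "?p ! (length ?p - 1) = last ?p" using i(1) by (subst last_conv_nth) auto
    also have "\<dots> = p ! i" using i(1) by (subst last_append) (auto simp: last_conv_nth)
    finally show ?thesis .
  qed
  moreover have "mset ?p = mset p"
    by (metis append_take_drop_id mset_append union_commute)
  moreover have "cycle_edges ?p = cycle_edges p"
    using cycle_edges_rotate[of "drop (Suc i) p" "take (Suc i) p"] by simp
  ultimately show ?thesis using that[of ?p] i(2) by metis
qed


section \<open>The upper bound\<close>

theorem theorem2p3:
  fixes V :: "'a set" and T C :: "'a set set"
    and pos :: "'a \<Rightarrow> complex" and \<gamma> :: "'a set \<Rightarrow> real \<Rightarrow> complex"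
  assumes "complete_halin_graph V T C pos \<gamma>"
    and "\<not> wheel V T C pos \<gamma>"
    and "max_degree V (T \<union> C) \<ge> 6"
  shows "star_chromatic_index V (T \<union> C) \<le> 3 * max_degree V (T \<union> C) div 2 + 1"
proof -
  define D where "D = max_degree V (T \<union> C)"
  define K where "K = 3 * D div 2"
  have D6: "6 \<le> D" using assms(3) by (simp add: D_def)
  have halin: "halin_graph V T C pos \<gamma>"
    using assms(1) unfolding complete_halin_graph_def by blast
  obtain r d where r: "r \<in> V" and level: "\<And>l. l \<in> leaves V T \<Longrightarrow> graph_dist V T r l = d"
    using assms(1) unfolding complete_halin_graph_def by blast
  have tree: "tree V T" and inner: "\<forall>v \<in> V - leaves V T. 3 \<le> degree T v"
    and cyc: "\<exists>p. graph_cycle V C p \<and> cycle_edges p = C \<and> set p = leaves V T"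
    using halin unfolding halin_graph_def by - (elim conjE, assumption)+
  obtain p0 where p0: "graph_cycle V C p0" "cycle_edges p0 = C" "set p0 = leaves V T"
    using cyc by (elim exE conjE)
  have p0': "distinct p0" "3 \<le> length p0" using p0(1) unfolding graph_cycle_def by blast+
  have leaf: "leaves V T \<noteq> {}" using p0(3) p0'(2) by auto
  have lt: "level_tree V T r d"
  proof (rule level_tree.intro)
    show "3 \<le> degree T v" if "v \<in> V - leaves V T" for v using inner that by (rule bspec)
    show "graph_dist V T r l = d" if "l \<in> leaves V T" for l by (rule level[OF that])
  qed (fact tree r leaf)+
  interpret level_tree V T r d by (rule lt)
  have "\<not> star V T" using assms(2) halin unfolding wheel_def by blast
  then obtain l l' where "l \<in> leaves V T" "l' \<in> leaves V T" "par l \<noteq> par l'"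
    by (rule two_leaf_parents)
  then have "l \<in> set p0" "l' \<in> set p0" "par l \<noteq> par l'" unfolding p0(3) .
  then obtain p where p: "mset p = mset p0" "cycle_edges p = cycle_edges p0"
    "par (p ! 0) \<noteq> par (p ! (length p - 1))"
    by (rule rotation_with_different_ends)
  have pp: "distinct p" "set p = leaves V T" "3 \<le> length p" "cycle_edges p = C"
    using p p0 p0' mset_eq_imp_distinct_iff[OF p(1)] mset_eq_setD[OF p(1)] mset_eq_length[OF p(1)] by simp_all
  have "finite C" unfolding pp(4)[symmetric] cycle_edges_def by simp
  have degD: "degree T v \<le> D" if "v \<in> V" for v
  proof -
    have "degree T v \<le> degree (T \<union> C) v"
      unfolding degree_def using finite_T \<open>finite C\<close> by (intro card_mono) auto
    also have "\<dots> \<le> D" unfolding D_def max_degree_def using that finite_V by (intro Max_ge) auto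
    finally show ?thesis .
  qed
  obtain c where c: "proper_edge_coloring T K c" "no_bicolored_walk T c"
    using tree_star_coloring[OF tree degD] D6 unfolding K_def by (metis gr0I not_numeral_le_zero)
  interpret leaf_cycle T p par c K
  proof
    show "par v \<notin> set p" if "v \<in> set p" for v using par_inner that pp(2) by blast
    show "e = {v, par v}" if e: "v \<in> set p" "e \<in> T" "v \<in> e" for v e
    proof -
      obtain x y where "e = {x, y}" using edge_card[OF e(2)] by (auto simp: card_2_iff)
      then obtain w where w: "e = {v, w}" using e(3) by auto
      then show ?thesis using neighbour_par[of v w] e pp(2) by simp
    qed
    show "par (p ! j) = par (p ! i)" if "i < j" "j < k" "k < length p" "par (p ! i) = par (p ! k)" for i j k
      by (rule children_contiguous[OF lt halin pp(1,4,2) p(3) that])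
    show "\<exists>w\<in>set p. w \<noteq> v \<and> par w = par v" if "v \<in> set p" for v
    proof (rule ccontr)
      assume "\<not> (\<exists>w\<in>set p. w \<noteq> v \<and> par w = par v)"
      then have "{w \<in> leaves V T. par w = par v} \<subseteq> {v}" using pp(2) by blast
      then have "card {w \<in> leaves V T. par w = par v} \<le> 1" using card_mono[of "{v}"] by auto
      then show False using leaf_children[of v] that pp(2) by simp
    qed
    \<comment> \<open>Here and in the next bound the maximum degree must be at least six: K - D = D div 2.\<close>
    show "degree T (par v) + 3 \<le> K" if "v \<in> set p" for v
      using degD[of "par v"] par_inner[of v] that pp(2) D6 unfolding K_def by fastforce
    show "9 \<le> K" using D6 unfolding K_def by simp
  qed (use pp p(3) finite_T edge_card par_edge par_degree c in simp_all)
  obtain col where "proper_edge_coloring (T \<union> C) (Suc K) col" "no_bicolored_walk (T \<union> C) col"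
    using star_coloring_with_cycle unfolding pp(4) by blast
  then have "star_edge_coloring V (T \<union> C) (Suc K) col" by (rule star_edge_coloringI)
  then have "star_chromatic_index V (T \<union> C) \<le> Suc K"
    unfolding star_chromatic_index_def by (intro Least_le) blast
  then show ?thesis by (simp add: K_def D_def)
qed

end
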